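(* Let $Q=Q(m,\Gamma)$ have at least three affine components that are Cartan matrices. Then $Q$ is realizable if and only if $Q$ has at most four components such that each affine component is the matrix $$C=\begin{pmatrix}2&-1&-1\\-1&2&-1\\-1&-1&2\end{pmatrix}$$ (the Cartan matrix of type $A_2^{(1)}$) and, if a finite component exists, then it is a principal submatrix of $C$.
   Context: For a finite simple graph $\Gamma$ on vertices $v_1,\dots,v_N$ and a vector $m=(m_1,\dots,m_N)$ of nonnegative integers, $Q(m,\Gamma)$ is the symmetric $N\times N$ matrix with diagonal entries $m_i$ and off-diagonal entries $-1$ if $\{v_i,v_j\}$ is an edge of $\Gamma$ and $0$ otherwise. The components of $Q$ are its indecomposable direct summands $Q_K$, $K\in\Pi$, where $\Pi$ is the partition of the index set into the connected components of $\Gamma$. A $k\times k$ component is finite if it is positive definite, and affine if it is positive semidefinite of rank $k-1$ with null space spanned by a vector with all coordinates positive. An affine component is a Cartan matrix if all its diagonal entries are $2$; equivalently it is the affine generalized Cartan matrix of an extended Dynkin diagram with single edges (types $A_\ell^{(1)}$, $\ell\ge2$; $D_\ell^{(1)}$, $\ell\ge4$; $E_\ell^{(1)}$, $\ell=6,7,8$). A realization of $Q$ is a $0$-$1$ matrix $J$ with $N$ columns such that any two columns both have entries $1$ in at most one common row, such that for every $K\in\Pi$ the submatrix of the columns indexed by $K$ has no zero rows, and such that $Q=J^tJ-E$ with $E$ the $N\times N$ all-ones matrix. $Q$ is realizable if it has a realization.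
   Formalization: In a realization, the condition that the columns of K have no zero rows is required only for components K that are not finite (else C+C+C+(2) is a counterexample); and the right-hand side also requires every component to be finite or affine, excluding indefinite ones. *)

theory Defs
  imports
    "Jordan_Normal_Form.Matrix_Kernel"
    "Jordan_Normal_Form.DL_Rank"
    "Jordan_Normal_Form.DL_Submatrix"
    "Graph_Theory.Graph_Theory"
begin

text \<open>
  A finite simple graph is a \<open>pair_graph\<close>: finite, loop-free, without parallel arcs, and with
  a symmetric arc relation, so that an edge \<open>{i, j}\<close> is the pair of arcs \<open>(i, j)\<close>, \<open>(j, i)\<close>.
  The vertices \<open>v\<^sub>1, \<dots>, v\<^sub>N\<close> are numbered \<open>0, \<dots>, N - 1\<close>, matching matrix indices.
\<close>

definition Q_mat :: "nat \<Rightarrow> (nat \<Rightarrow> nat) \<Rightarrow> nat pair_pre_digraph \<Rightarrow> real mat" where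
  "Q_mat N m G =
     mat N N (\<lambda>(i, j). if i = j then real (m i) else if (i, j) \<in> parcs G then - 1 else 0)"

text \<open>
  For a symmetric arc relation, the strongly connected components are the connected components.
\<close>

definition components :: "nat pair_pre_digraph \<Rightarrow> nat set set" where
  "components G = pre_digraph.sccs_verts (with_proj G)"

text \<open>
  \<open>submatrix\<close> keeps the increasing order of the selected indices.
\<close>

definition component_mat :: "real mat \<Rightarrow> nat set \<Rightarrow> real mat" where
  "component_mat Q K = submatrix Q K K"

definition positive_definite :: "real mat \<Rightarrow> bool" where
  "positive_definite A \<longleftrightarrow>
     (\<forall>v \<in> carrier_vec (dim_row A). v \<noteq> 0\<^sub>v (dim_row A) \<longrightarrow> v \<bullet> (A *\<^sub>v v) > 0)"

definition positive_semidefinite :: "real mat \<Rightarrow> bool" where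
  "positive_semidefinite A \<longleftrightarrow> (\<forall>v \<in> carrier_vec (dim_row A). v \<bullet> (A *\<^sub>v v) \<ge> 0)"

definition finite_type :: "real mat \<Rightarrow> bool" where
  "finite_type A \<longleftrightarrow> positive_definite A"

definition affine_type :: "real mat \<Rightarrow> bool" where
  "affine_type A \<longleftrightarrow>
     positive_semidefinite A \<and>
     vec_space.rank (dim_row A) A = dim_row A - 1 \<and>
     (\<exists>\<delta> \<in> carrier_vec (dim_row A).
        (\<forall>i < dim_row A. \<delta> $ i > 0) \<and> mat_kernel A = range (\<lambda>c. c \<cdot>\<^sub>v \<delta>))"

definition affine_cartan :: "real mat \<Rightarrow> bool" where
  "affine_cartan A \<longleftrightarrow> affine_type A \<and> (\<forall>i < dim_row A. A $$ (i, i) = 2)"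

definition cartan_A2 :: "real mat" where
  "cartan_A2 = mat_of_rows_list 3 [[2, -1, -1], [-1, 2, -1], [-1, -1, 2]]"

definition principal_submatrix :: "real mat \<Rightarrow> real mat \<Rightarrow> bool" where
  "principal_submatrix B A \<longleftrightarrow> (\<exists>I \<subseteq> {0..<dim_row A}. B = submatrix A I I)"

text \<open>
  The columns of a realization indexed by a component are required to have no zero row only if
  the component is not finite. Finite components have to be exempt: for
  \<open>Q = C \<oplus> C \<oplus> C \<oplus> (2)\<close> with \<open>C = cartan_A2\<close>, the columns of each \<open>C\<close> are three pairwise
  disjoint triples of rows, so if they have no zero row, then \<open>J\<close> has nine rows, of which the
  last column meets only three. In the presence of three affine Cartan components, no finite
  component could occur in a realization if it were subject to the condition.
\<close>

definition realization :: "nat pair_pre_digraph \<Rightarrow> real mat \<Rightarrow> real mat \<Rightarrow> bool" where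
  "realization G Q J \<longleftrightarrow>
     dim_col J = dim_row Q \<and>
     elements_mat J \<subseteq> {0, 1} \<and>
     (\<forall>j < dim_col J. \<forall>k < dim_col J. j \<noteq> k \<longrightarrow>
        card {i. i < dim_row J \<and> J $$ (i, j) = 1 \<and> J $$ (i, k) = 1} \<le> 1) \<and>
     (\<forall>K \<in> components G. \<not> finite_type (component_mat Q K) \<longrightarrow>
        (\<forall>i < dim_row J. row (submatrix J UNIV K) i \<noteq> 0\<^sub>v (card K))) \<and>
     Q = transpose_mat J * J - mat (dim_row Q) (dim_row Q) (\<lambda>_. 1)"

definition realizable :: "nat pair_pre_digraph \<Rightarrow> real mat \<Rightarrow> bool" where
  "realizable G Q \<longleftrightarrow> (\<exists>J. realization G Q J)"

end

theory Submission
  imports Defs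
begin

text \<open>
  Read the columns of a realization as sets of rows. The equation \<open>Q = J\<^sup>t J - E\<close> says that column
  \<open>i\<close> has \<open>m i + 1\<close> rows, that adjacent vertices have disjoint columns, and that distinct nonadjacent
  vertices have columns with exactly one common row. An affine Cartan component is thus a family of
  triples that covers all rows (its null vector prevents it from being finite), and columns from two different components always meet in one row.

  Let \<open>K\<close>, \<open>L\<close>, \<open>M\<close> be three affine Cartan components. An edge of \<open>K\<close> gives two disjoint triples, and
  every column of \<open>L\<close> or \<open>M\<close> meets each of them in one row. Two columns share at most one row, so the
  columns of \<open>L\<close> and \<open>M\<close> inject into the \<open>3 * 3\<close> pairs: \<open>card L + card M \<le> 9\<close> (\<open>block_sizes\<close>).
  By symmetry, two of the three components have at most four vertices. The positive null vector of
  the component then leaves only the triangle, which forces nine rows, and the 4-cycle, which forces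
  ten (\<open>small_block\<close>). Hence the two small components have the same shape, and two 4-cycles together
  with a column of the third component are contradictory (\<open>no_two_squares\<close>).

  So two components are triangles (\<open>two_triangles\<close>). Each of them partitions the nine rows into three
  triples, and the two partitions are the rows and the columns of a \<open>3 \<times> 3\<close> grid. Every other column
  of the realization is a transversal of the grid, i.e. the graph of a permutation of three points.
  The six permutations are the lines of the two remaining parallel classes of the affine plane of
  order 3, according to parity. All columns are therefore lines of this plane
  (\<open>columns_are_lines\<close>); parallel lines are disjoint and lines of different classes meet in one point,
  so that components are sets of parallel lines: at most four of them, with at most three vertices
  each, complete, and with all diagonal entries 2.

  Conversely, if the components have this form, they can be assigned to different parallel classes
  and their vertices to lines of the class; the incidence matrix of the plane, restricted to the
  chosen lines, is a realization. Both directions thus pass through the existence of a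
  \<open>plane_labelling\<close>.
\<close>

section \<open>Positive null vectors on at most four vertices\<close>

text \<open>
  For symmetric \<open>E\<close>, the equations say that \<open>d\<close> is a positive null vector of the matrix with diagonal 2
  whose off-diagonal entries are -1 on \<open>E\<close>. Single-edged extended Dynkin diagrams on at most four
  vertices are \<open>A\<^sub>2\<^sup>(\<^sup>1\<^sup>)\<close> and \<open>A\<^sub>3\<^sup>(\<^sup>1\<^sup>)\<close>; for so few vertices this is checked by running through all
  graphs.
\<close>

lemma affine_vector_small:
  fixes d :: "'v \<Rightarrow> real"
  assumes fin: "finite K" and ne: "K \<noteq> {}" and card: "card K \<le> 4"
    and sym: "sym E" and irr: "irrefl E"
    and pos: "\<And>v. v \<in> K \<Longrightarrow> d v > 0"
    and null: "\<And>v. v \<in> K \<Longrightarrow> 2 * d v = (\<Sum>w \<in> {w \<in> K. (v, w) \<in> E}. d w)"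
  obtains (triangle) a b c where "distinct [a, b, c]" "K = {a, b, c}"
      "(a, b) \<in> E" "(b, c) \<in> E" "(a, c) \<in> E"
  | (square) a b c e where "distinct [a, b, c, e]" "K = {a, b, c, e}"
      "(a, b) \<in> E" "(b, c) \<in> E" "(c, e) \<in> E" "(e, a) \<in> E"
      "(a, c) \<notin> E" "(b, e) \<notin> E"
proof -
  have nosq: "(v, v) \<notin> E" for v using irr by (auto simp: irrefl_def)
  have sw: "(v, w) \<in> E \<longleftrightarrow> (w, v) \<in> E" for v w using sym by (auto simp: sym_def)
  have null': "2 * d v = (\<Sum>w \<in> K. if (v, w) \<in> E then d w else 0)" if "v \<in> K" for v
    unfolding null[OF that] by (rule sum.inter_filter[OF fin])
  have "card K > 0" using fin ne by (simp add: card_gt_0_iff)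
  then consider "card K = 1" | "card K = 2" | "card K = 3" | "card K = 4" using card by linarith
  then show thesis
  proof cases
    case 1
    then obtain a where K: "K = {a}" by (auto simp: card_1_singleton_iff)
    show ?thesis using null'[of a] pos[of a] by (simp add: K nosq)
  next
    case 2
    then obtain a b where K: "K = {a, b}" "a \<noteq> b" by (auto simp: card_2_iff)
    show ?thesis using null'[of a] null'[of b] pos[of a] pos[of b] K
      by (simp add: nosq sw[of b a] split: if_splits)
  next
    case 3
    then obtain a b c where K: "K = {a, b, c}" and ab: "a \<noteq> b" "a \<noteq> c" "b \<noteq> c"
      by (auto simp: card_3_iff)
    have "(a, b) \<in> E \<and> (b, c) \<in> E \<and> (a, c) \<in> E"
      using null'[of a] null'[of b] null'[of c] pos[of a] pos[of b] pos[of c] ab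
      by (simp add: K nosq sw[of b a] sw[of c a] sw[of c b] split: if_splits)
    then show ?thesis using triangle K ab by simp
  next
    case 4
    then obtain a b c e where K: "K = {a, b, c, e}" and ab: "distinct [a, b, c, e]"
      by (auto simp: card_Suc_eq numeral_eq_Suc)
    have "((a, b) \<in> E \<and> (b, c) \<in> E \<and> (c, e) \<in> E \<and> (e, a) \<in> E \<and> (a, c) \<notin> E \<and> (b, e) \<notin> E) \<or>
       ((a, c) \<in> E \<and> (c, b) \<in> E \<and> (b, e) \<in> E \<and> (e, a) \<in> E \<and> (a, b) \<notin> E \<and> (c, e) \<notin> E) \<or>
       ((a, b) \<in> E \<and> (b, e) \<in> E \<and> (e, c) \<in> E \<and> (c, a) \<in> E \<and> (a, e) \<notin> E \<and> (b, c) \<notin> E)"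
      using null'[of a] null'[of b] null'[of c] null'[of e] pos[of a] pos[of b] pos[of c] pos[of e] ab
      by (simp add: K nosq sw[of b a] sw[of c a] sw[of c b] sw[of e a] sw[of e b] sw[of e c]
          split: if_splits)
    then show ?thesis using square[of a b c e] square[of a c b e] square[of a b e c] K ab
      by (auto simp: insert_commute)
  qed
qed

section \<open>The affine plane of order 3\<close>

text \<open>
  The nine points of the plane are the pairs of residues modulo 3, and the four parallel classes are
  given by the level sets of the linear forms \<open>x\<close>, \<open>y\<close>, \<open>x + y\<close> and \<open>x + 2y\<close>.
\<close>

definition grid :: "(nat \<times> nat) set" where
  "grid = {..<3} \<times> {..<3}"

definition slope :: "nat \<Rightarrow> nat \<times> nat \<Rightarrow> nat" where
  "slope c p = (if c = 0 then fst p else if c = 1 then snd p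
     else if c = 2 then (fst p + snd p) mod 3 else (fst p + 2 * snd p) mod 3)"

definition line :: "nat \<Rightarrow> nat \<Rightarrow> (nat \<times> nat) set" where
  "line c t = {p \<in> grid. slope c p = t}"

lemma lessThan_3: "{..<3} = {0, 1, 2 :: nat}" by auto

lemma less_3_cases:
  "x < (3::nat) \<Longrightarrow> (x = 0 \<Longrightarrow> P) \<Longrightarrow> (x = 1 \<Longrightarrow> P) \<Longrightarrow> (x = 2 \<Longrightarrow> P) \<Longrightarrow> P"
  by linarith

lemma less_4_cases:
  "x < (4::nat) \<Longrightarrow> (x = 0 \<Longrightarrow> P) \<Longrightarrow> (x = 1 \<Longrightarrow> P) \<Longrightarrow> (x = 2 \<Longrightarrow> P) \<Longrightarrow> (x = 3 \<Longrightarrow> P) \<Longrightarrow> P"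
  by linarith

text \<open>
  As a double sum with explicit index sets, the cardinality of a set of grid points can be computed by
  rewriting.
\<close>

lemma card_grid_filter:
  "card {p \<in> grid. P p} = (\<Sum>x\<in>{0, 1, 2}. \<Sum>y\<in>{0, 1, 2}. if P (x, y) then 1 else 0)"
proof -
  have "card {p \<in> grid. P p} = (\<Sum>p\<in>grid. if P p then 1 else 0)"
    unfolding card_eq_sum by (rule sum.inter_filter) (simp add: grid_def)
  then show ?thesis by (simp only: grid_def sum.cartesian_product lessThan_3 split_def prod.collapse)
qed

lemma card_line:
  assumes "c < 4" "t < 3"
  shows "card (line c t) = 3"
  unfolding line_def card_grid_filter
  using assms by (elim less_3_cases less_4_cases) (simp_all add: slope_def)

lemma line_Int_parallel: "t \<noteq> t' \<Longrightarrow> line c t \<inter> line c t' = {}"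
  by (auto simp: line_def)

lemma card_line_Int:
  assumes "c < 4" "c' < 4" "c \<noteq> c'" "t < 3" "t' < 3"
  shows "card (line c t \<inter> line c' t') = 1"
proof -
  have "line c t \<inter> line c' t' = {p \<in> grid. slope c p = t \<and> slope c' p = t'}"
    by (auto simp: line_def)
  then show ?thesis using assms
    by (elim less_3_cases less_4_cases) (simp_all add: card_grid_filter slope_def)
qed

lemma slope_less: "p \<in> grid \<Longrightarrow> slope c p < 3"
  by (auto simp: grid_def slope_def)

text \<open>
  A set with one point on every horizontal and every vertical line is the graph of a permutation \<open>f\<close> of
  the residues modulo 3. The affine maps \<open>x \<mapsto> t - x\<close> and \<open>x \<mapsto> t + x\<close> are six permutations, hence all
  of them, and their graphs are the lines of the other two classes.
\<close>

lemma transversal_is_line: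
  assumes "T \<subseteq> grid"
    and rows: "\<And>x. x < 3 \<Longrightarrow> \<exists>!p. p \<in> T \<and> p \<in> line 0 x"
    and cols: "\<And>y. y < 3 \<Longrightarrow> \<exists>!p. p \<in> T \<and> p \<in> line 1 y"
  obtains c t where "c \<in> {2, 3}" "t < 3" "T = line c t"
proof -
  have l0: "p \<in> T \<and> p \<in> line 0 x \<longleftrightarrow> p \<in> T \<and> fst p = x" for p x
    using assms(1) by (auto simp: line_def slope_def)
  have l1: "p \<in> T \<and> p \<in> line 1 y \<longleftrightarrow> p \<in> T \<and> snd p = y" for p y
    using assms(1) by (auto simp: line_def slope_def)
  have "\<exists>y. \<forall>p. p \<in> T \<and> fst p = x \<longleftrightarrow> p = (x, y)" if x: "x < 3" for x
  proof -
    obtain p where p: "p \<in> T" "fst p = x" "\<And>q. q \<in> T \<and> fst q = x \<Longrightarrow> q = p"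
      using rows[OF x] unfolding l0 Ex1_def by blast
    have "p = (x, snd p)" using p(2) by (simp add: prod_eq_iff)
    then have "\<forall>q. q \<in> T \<and> fst q = x \<longleftrightarrow> q = (x, snd p)" using p by metis
    then show ?thesis ..
  qed
  then obtain f where f: "\<And>x p. x < 3 \<Longrightarrow> p \<in> T \<and> fst p = x \<longleftrightarrow> p = (x, f x)"
    by metis
  have fT: "(x, f x) \<in> T" if "x < 3" for x using f[OF that, of "(x, f x)"] by simp
  have f3: "f x < 3" if "x < 3" for x using fT[OF that] assms(1) unfolding grid_def by blast
  have inj: "x = x'" if x: "x < 3" "x' < 3" and eq: "f x = f x'" for x x'
  proof -
    obtain p where p: "\<And>q. q \<in> T \<and> snd q = f x \<Longrightarrow> q = p"
      using cols[OF f3[OF x(1)]] unfolding l1 Ex1_def by blast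
    show ?thesis using p[of "(x, f x)"] p[of "(x', f x')"] fT[OF x(1)] fT[OF x(2)] eq by simp
  qed
  have T: "T = {(0, f 0), (1, f 1), (2, f 2)}"
  proof
    show "T \<subseteq> {(0, f 0), (1, f 1), (2, f 2)}"
    proof
      fix p assume p: "p \<in> T"
      obtain x y where xy: "p = (x, y)" by (cases p)
      have "x < 3" using p xy assms(1) by (auto simp: grid_def)
      then show "p \<in> {(0, f 0), (1, f 1), (2, f 2)}" using f[of x p] p xy
        by (elim less_3_cases) simp_all
    qed
  qed (use fT[of 0] fT[of 1] fT[of 2] in simp)
  have "f 0 \<noteq> f 1" "f 0 \<noteq> f 2" "f 1 \<noteq> f 2" using inj[of 0 1] inj[of 0 2] inj[of 1 2] by auto
  \<comment> \<open>The class depends on the parity of \<open>f\<close>; the line is the one of that class through \<open>(0, f 0)\<close>.\<close>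
  then have "\<exists>c\<in>{2, 3}. \<forall>p\<in>T. slope c p = slope c (0, f 0)"
    unfolding T using f3[of 0, simplified] f3[of 1, simplified] f3[of 2, simplified]
    by (elim less_3_cases) (simp_all add: slope_def)
  then obtain c where c: "c \<in> {2, 3}" "T \<subseteq> line c (slope c (0, f 0))"
    using assms(1) by (auto simp: line_def)
  have t: "slope c (0, f 0) < 3" using f3[of 0] by (intro slope_less) (simp add: grid_def)
  have "finite (line c (slope c (0, f 0)))" by (simp add: line_def grid_def)
  moreover have "card T = card (line c (slope c (0, f 0)))"
    using c(1) t by (subst card_line) (auto simp: T)
  ultimately have "T = line c (slope c (0, f 0))" using c(2) card_subset_eq by blast
  then show thesis using that c(1) t by blast
qed

section \<open>Families of triples with prescribed intersections\<close>

text \<open>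
  A set that meets \<open>A\<close> and \<open>B\<close> in one point each determines a pair in \<open>A \<times> B\<close>; two sets with the same
  pair would have two points in common.
\<close>

lemma card_common_transversals_le:
  assumes A: "finite A" and B: "finite B"
    and meet: "\<And>x. x \<in> X \<Longrightarrow> card (S x \<inter> A) = 1 \<and> card (S x \<inter> B) = 1"
    and disj: "A \<inter> B = {}"
    and few: "\<And>x y. x \<in> X \<Longrightarrow> y \<in> X \<Longrightarrow> x \<noteq> y \<Longrightarrow> card (S x \<inter> S y) \<le> 1"
    and fin: "\<And>x. x \<in> X \<Longrightarrow> finite (S x)"
  shows "card X \<le> card A * card B"
proof -
  have "\<forall>x\<in>X. \<exists>r. S x \<inter> A = {r}" "\<forall>x\<in>X. \<exists>r. S x \<inter> B = {r}"
    using meet by (simp_all add: card_1_singleton_iff)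
  then obtain f g where f: "\<And>x. x \<in> X \<Longrightarrow> S x \<inter> A = {f x}" and g: "\<And>x. x \<in> X \<Longrightarrow> S x \<inter> B = {g x}"
    by metis
  have "inj_on (\<lambda>x. (f x, g x)) X"
  proof (rule inj_onI, rule ccontr)
    fix x y assume x: "x \<in> X" "y \<in> X" "(f x, g x) = (f y, g y)" "x \<noteq> y"
    then have "{f x, g x} \<subseteq> S x \<inter> S y" using f[of x] f[of y] g[of x] g[of y] by auto
    moreover have "f x \<noteq> g x" using f[of x] g[of x] x(1) disj by blast
    ultimately have "2 \<le> card (S x \<inter> S y)" using fin[OF x(1)]
      by (metis card_2_iff card_mono finite_Int)
    then show False using few[OF x(1,2,4)] by auto
  qed
  moreover have "(\<lambda>x. (f x, g x)) ` X \<subseteq> A \<times> B" using f g by blast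
  ultimately have "card X \<le> card (A \<times> B)"
    using A B by (intro card_inj_on_le[of _ X]) auto
  then show ?thesis by (simp add: card_cartesian_product)
qed

locale column_family =
  fixes V :: "'v set" and E :: "'v rel" and S :: "'v \<Rightarrow> 'r set"
  assumes finite_column: "i \<in> V \<Longrightarrow> finite (S i)"
    and sym_E: "sym E" and irrefl_E: "irrefl E"
    and adjacent: "i \<in> V \<Longrightarrow> j \<in> V \<Longrightarrow> (i, j) \<in> E \<Longrightarrow> S i \<inter> S j = {}"
    and nonadjacent: "i \<in> V \<Longrightarrow> j \<in> V \<Longrightarrow> i \<noteq> j \<Longrightarrow> (i, j) \<notin> E \<Longrightarrow> card (S i \<inter> S j) = 1"
begin

definition rows :: "'r set" where
  "rows = (\<Union>i\<in>V. S i)"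

text \<open>
  What is used of an affine Cartan component of a realization. The equations for \<open>d\<close> express that \<open>d\<close> is
  a null vector of the matrix of the component, whose diagonal entries are 2.
\<close>

definition affine_block :: "'v set \<Rightarrow> bool" where
  "affine_block K \<longleftrightarrow> K \<subseteq> V \<and> finite K \<and> K \<noteq> {} \<and>
     (\<forall>v\<in>K. card (S v) = 3) \<and> rows = (\<Union>v\<in>K. S v) \<and>
     (\<forall>v\<in>K. \<forall>w\<in>V - K. (v, w) \<notin> E) \<and>
     (\<exists>d :: 'v \<Rightarrow> real. \<forall>v\<in>K. d v > 0 \<and> 2 * d v = (\<Sum>w \<in> {w \<in> K. (v, w) \<in> E}. d w))"

lemma affine_blockD:
  assumes "affine_block K"
  shows "K \<subseteq> V" "finite K" "K \<noteq> {}" "v \<in> K \<Longrightarrow> card (S v) = 3" "rows = (\<Union>v\<in>K. S v)"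
    "v \<in> K \<Longrightarrow> w \<in> V \<Longrightarrow> w \<notin> K \<Longrightarrow> (v, w) \<notin> E"
  using assms unfolding affine_block_def by blast+

lemma meets_block:
  assumes K: "affine_block K" and "v \<in> K" "u \<in> V" "u \<notin> K"
  shows "card (S u \<inter> S v) = 1"
proof -
  have "(u, v) \<notin> E" using affine_blockD(6)[OF K assms(2-4)] sym_E by (auto dest: symD)
  moreover have "v \<in> V" using affine_blockD(1)[OF K] assms by auto
  ultimately show ?thesis using nonadjacent[of u v] assms by auto
qed

lemma card_Int_columns: "i \<in> V \<Longrightarrow> j \<in> V \<Longrightarrow> i \<noteq> j \<Longrightarrow> card (S i \<inter> S j) \<le> 1"
  using adjacent nonadjacent by (metis card.empty order_refl zero_le)

text \<open>
  A positive null vector excludes isolated vertices, so \<open>K\<close> has an edge. Its two columns are disjoint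
  triples that meet all columns of \<open>L\<close> and \<open>M\<close>.
\<close>

lemma block_sizes:
  assumes K: "affine_block K" and L: "affine_block L" and M: "affine_block M"
    and disj: "K \<inter> L = {}" "K \<inter> M = {}" "L \<inter> M = {}"
  shows "card L + card M \<le> 9"
proof -
  obtain d :: "'v \<Rightarrow> real" where d: "\<forall>v\<in>K. d v > 0 \<and> 2 * d v = (\<Sum>w \<in> {w \<in> K. (v, w) \<in> E}. d w)"
    using K unfolding affine_block_def by blast
  obtain a where a: "a \<in> K" using affine_blockD(3)[OF K] by blast
  have "{w \<in> K. (a, w) \<in> E} \<noteq> {}"
  proof
    assume none: "{w \<in> K. (a, w) \<in> E} = {}"
    show False using bspec[OF d a] unfolding none by auto
  qed
  then obtain b where b: "b \<in> K" "(a, b) \<in> E" by blast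
  have ab: "a \<in> V" "b \<in> V" using affine_blockD(1)[OF K] a b by auto
  have V: "x \<in> V \<and> x \<notin> K" if "x \<in> L \<union> M" for x
    using that affine_blockD(1)[OF L] affine_blockD(1)[OF M] disj by blast
  have "card (L \<union> M) \<le> card (S a) * card (S b)"
  proof (rule card_common_transversals_le)
    show "S a \<inter> S b = {}" using adjacent ab b(2) by blast
    show "card (S x \<inter> S a) = 1 \<and> card (S x \<inter> S b) = 1" if "x \<in> L \<union> M" for x
      using V[OF that] meets_block[OF K] a b(1) by blast
    show "card (S x \<inter> S y) \<le> 1" if "x \<in> L \<union> M" "y \<in> L \<union> M" "x \<noteq> y" for x y
      using V that card_Int_columns by blast
  qed (use V ab finite_column in blast)+
  then show ?thesis
    using affine_blockD(2,4)[OF K] affine_blockD(2)[OF L] affine_blockD(2)[OF M] a b disj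
    by (simp add: card_Un_disjoint)
qed

definition clique :: "'v set \<Rightarrow> bool" where
  "clique K \<longleftrightarrow> (\<forall>v\<in>K. \<forall>w\<in>K. v \<noteq> w \<longrightarrow> (v, w) \<in> E)"

text \<open>
  The number of rows tells the two shapes apart: three disjoint triples cover \<open>3 + 3 + 3\<close> rows, and the
  two pairs of opposite vertices of a 4-cycle cover \<open>3 + 3 - 1\<close> rows each.
\<close>

lemma small_block:
  assumes K: "affine_block K" and "card K \<le> 4"
  obtains (triangle) "card K = 3" "clique K" "card rows = 9"
  | (square) a b c e where "distinct [a, b, c, e]" "K = {a, b, c, e}"
      "(a, b) \<in> E" "(b, c) \<in> E" "(c, e) \<in> E" "(e, a) \<in> E"
      "(a, c) \<notin> E" "(b, e) \<notin> E" "card rows = 10"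
proof -
  obtain d :: "'v \<Rightarrow> real" where d: "\<forall>v\<in>K. d v > 0 \<and> 2 * d v = (\<Sum>w \<in> {w \<in> K. (v, w) \<in> E}. d w)"
    using K unfolding affine_block_def by blast
  note fin = finite_column[OF subsetD[OF affine_blockD(1)[OF K]]]
  note c3 = affine_blockD(4)[OF K]
  note sub = affine_blockD(1)[OF K]
  show thesis
  proof (rule affine_vector_small[of K E d])
    fix a b c assume *: "distinct [a, b, c]" "K = {a, b, c}" "(a, b) \<in> E" "(b, c) \<in> E" "(a, c) \<in> E"
    have dj: "S a \<inter> S b = {}" "S a \<inter> S c = {}" "S b \<inter> S c = {}"
      using * sub by (simp_all add: adjacent)
    have "rows = S a \<union> (S b \<union> S c)" using affine_blockD(5)[OF K] *(2) by auto
    then have "card rows = 9"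
      using dj fin[of a] fin[of b] fin[of c] c3[of a] c3[of b] c3[of c] *(2)
      by (simp add: card_Un_disjoint Int_Un_distrib)
    moreover have "clique K" using * sym_E by (auto simp: clique_def dest: symD)
    ultimately show thesis using triangle * by simp
  next
    fix a b c e
    assume *: "distinct [a, b, c, e]" "K = {a, b, c, e}"
      "(a, b) \<in> E" "(b, c) \<in> E" "(c, e) \<in> E" "(e, a) \<in> E" "(a, c) \<notin> E" "(b, e) \<notin> E"
    have dj: "S a \<inter> S b = {}" "S b \<inter> S c = {}" "S c \<inter> S e = {}" "S e \<inter> S a = {}"
      using * sub by (simp_all add: adjacent)
    have one: "card (S a \<inter> S c) = 1" "card (S b \<inter> S e) = 1"
      using * sub by (simp_all add: nonadjacent)
    have "card (S a \<union> S c) = 5" "card (S b \<union> S e) = 5"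
      using card_Un_Int[of "S a" "S c"] card_Un_Int[of "S b" "S e"] one
        fin[of a] fin[of b] fin[of c] fin[of e] c3[of a] c3[of b] c3[of c] c3[of e] *(2) by simp_all
    moreover have "rows = (S a \<union> S c) \<union> (S b \<union> S e)" using affine_blockD(5)[OF K] *(2) by auto
    moreover have "(S a \<union> S c) \<inter> (S b \<union> S e) = {}" using dj by blast
    ultimately have "card rows = 10"
      using fin[of a] fin[of b] fin[of c] fin[of e] *(2) by (simp add: card_Un_disjoint)
    then show thesis using square * by blast
  qed (use d affine_blockD(2,3)[OF K] assms(2) sym_E irrefl_E in \<open>blast | simp\<close>)+
qed

lemma three_eq_one_or_two:
  "(3::nat) = (if P then 1 else 2) + (if Q then 1 else 2) \<Longrightarrow> P \<longleftrightarrow> \<not> Q"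
  by (simp split: if_splits)

text \<open>
  In a 4-cycle \<open>a, b, c, e\<close>, opposite columns share one row, \<open>r\<close> or \<open>r'\<close>, and the five rows of
  \<open>S a \<union> S c\<close> and the five rows of \<open>S b \<union> S e\<close> form a partition of all rows. A column \<open>S u\<close> outside the
  block meets each of the two parts in one row if it contains the common row of that part, and in two
  rows otherwise. Since \<open>S u\<close> has three rows, it contains exactly one of \<open>r\<close> and \<open>r'\<close>.
\<close>

lemma square_transversal:
  assumes K: "affine_block K" and sq: "K = {a, b, c, e}"
      "(a, b) \<in> E" "(b, c) \<in> E" "(c, e) \<in> E" "(e, a) \<in> E"
    and r: "S a \<inter> S c = {r}" and r': "S b \<inter> S e = {r'}"
    and u: "u \<in> V" "u \<notin> K" "card (S u) = 3"
  shows "r \<in> S u \<longleftrightarrow> r' \<notin> S u" and "r \<in> S u \<Longrightarrow> card (S u \<inter> (S b \<union> S e)) = 2"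
proof -
  note sub = affine_blockD(1)[OF K]
  have split: "card (S u \<inter> (S v \<union> S w)) = (if q \<in> S u then 1 else 2)"
    if "v \<in> K" "w \<in> K" "S v \<inter> S w = {q}" for v w q
  proof -
    have "card (S u \<inter> S v) + card (S u \<inter> S w) =
        card (S u \<inter> S v \<union> S u \<inter> S w) + card (S u \<inter> S v \<inter> (S u \<inter> S w))"
      using finite_column[OF u(1)] by (intro card_Un_Int) auto
    also have "S u \<inter> S v \<union> S u \<inter> S w = S u \<inter> (S v \<union> S w)" by blast
    also have "S u \<inter> S v \<inter> (S u \<inter> S w) = S u \<inter> {q}" using that(3) by blast
    also have "card (S u \<inter> {q}) = (if q \<in> S u then 1 else 0)" by simp
    finally show ?thesis
      unfolding meets_block[OF K that(1) u(1,2)] meets_block[OF K that(2) u(1,2)]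
      by (cases "q \<in> S u") simp_all
  qed
  have dj: "S a \<inter> S b = {}" "S b \<inter> S c = {}" "S c \<inter> S e = {}" "S e \<inter> S a = {}"
    using sq sub by (simp_all add: adjacent)
  have "S u \<subseteq> rows" using u by (auto simp: rows_def)
  then have "S u = S u \<inter> (S a \<union> S c) \<union> S u \<inter> (S b \<union> S e)"
    unfolding affine_blockD(5)[OF K] sq(1) by blast
  moreover have "card (S u \<inter> (S a \<union> S c) \<union> S u \<inter> (S b \<union> S e)) =
      card (S u \<inter> (S a \<union> S c)) + card (S u \<inter> (S b \<union> S e))"
    using dj finite_column[OF u(1)] by (intro card_Un_disjoint) auto
  ultimately have three: "3 = card (S u \<inter> (S a \<union> S c)) + card (S u \<inter> (S b \<union> S e))"
    using u(3) by metis
  have ac: "card (S u \<inter> (S a \<union> S c)) = (if r \<in> S u then 1 else 2)"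
    by (rule split[OF _ _ r]) (simp_all add: sq(1))
  have be: "card (S u \<inter> (S b \<union> S e)) = (if r' \<in> S u then 1 else 2)"
    by (rule split[OF _ _ r']) (simp_all add: sq(1))
  show iff: "r \<in> S u \<longleftrightarrow> r' \<notin> S u"
    by (rule three_eq_one_or_two) (rule three[unfolded ac be])
  show "card (S u \<inter> (S b \<union> S e)) = 2" if "r \<in> S u"
    unfolding be using iff that by (simp only: if_False simp_thms)
qed

text \<open>
  Three triples through \<open>r\<close> that have no other common rows would leave three disjoint pairs in
  \<open>(S b \<union> S e) - {r'}\<close>, a set with four elements only.
\<close>

lemma square_no_three_through_corner:
  assumes K: "affine_block K" and sq: "K = {a, b, c, e}"
      "(a, b) \<in> E" "(b, c) \<in> E" "(c, e) \<in> E" "(e, a) \<in> E"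
    and r: "S a \<inter> S c = {r}" and r': "S b \<inter> S e = {r'}"
    and out: "{u, v, w} \<subseteq> V - K" "card (S u) = 3" "card (S v) = 3" "card (S w) = 3"
    and one: "card (S u \<inter> S v) = 1" "card (S u \<inter> S w) = 1" "card (S v \<inter> S w) = 1"
    and through: "r \<in> S u" "r \<in> S v" "r \<in> S w"
  shows False
proof -
  let ?B = "S b \<union> S e"
  note sub = affine_blockD(1)[OF K]
  have dj: "S a \<inter> S b = {}" "S e \<inter> S a = {}"
    using sq sub by (simp_all add: adjacent)
  have rB: "r \<notin> ?B" using dj r by blast
  have fin: "finite (S b)" "finite (S e)" using finite_column sub sq(1) by auto
  have "card ?B = 5"
    using card_Un_Int[OF fin] r' affine_blockD(4)[OF K] sq(1) by auto
  then have B: "card (?B - {r'}) = 4" using r' fin by (subst card_Diff_singleton) auto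
  have pair: "card (S x \<inter> ?B) = 2 \<and> S x \<inter> ?B \<subseteq> ?B - {r'}" if "x \<in> {u, v, w}" for x
  proof -
    have "x \<in> V" "x \<notin> K" "card (S x) = 3" "r \<in> S x" using that out through by auto
    then show ?thesis using square_transversal[OF K sq r r', of x] by auto
  qed
  have disj: "(S x \<inter> ?B) \<inter> (S y \<inter> ?B) = {}" if "card (S x \<inter> S y) = 1" "r \<in> S x" "r \<in> S y" for x y
  proof -
    have "S x \<inter> S y = {r}" using that by (metis IntI card_1_singletonE singletonD)
    then have "(S x \<inter> ?B) \<inter> (S y \<inter> ?B) = {r} \<inter> ?B" by blast
    then show ?thesis using rB by simp
  qed
  have fB: "finite (S x \<inter> ?B)" for x using fin by simp
  have "card ((S u \<inter> ?B) \<union> ((S v \<inter> ?B) \<union> (S w \<inter> ?B))) = 6"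
    using disj[OF one(1)] disj[OF one(2)] disj[OF one(3)] through pair fB
    by (subst card_Un_disjoint, simp, simp, blast, subst card_Un_disjoint) auto
  moreover have "card ((S u \<inter> ?B) \<union> ((S v \<inter> ?B) \<union> (S w \<inter> ?B))) \<le> card (?B - {r'})"
    using pair fin by (intro card_mono) auto
  ultimately show False using B by simp
qed

text \<open>
  Each column of the second 4-cycle \<open>p, q, s, t\<close> and the extra column \<open>S u\<close> contain exactly one of \<open>r\<close>
  and \<open>r'\<close>. Adjacent columns are disjoint, so \<open>S p\<close> and \<open>S s\<close> contain one of the two rows and \<open>S q\<close> and
  \<open>S t\<close> the other. Whichever row \<open>S u\<close> contains is then on three triples.
\<close>

lemma no_two_squares:
  assumes K: "affine_block K" and sq: "K = {a, b, c, e}" "distinct [a, b, c, e]"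
      "(a, b) \<in> E" "(b, c) \<in> E" "(c, e) \<in> E" "(e, a) \<in> E" "(a, c) \<notin> E" "(b, e) \<notin> E"
    and L: "affine_block L" and sq': "L = {p, q, s, t}" "distinct [p, q, s, t]"
      "(p, q) \<in> E" "(q, s) \<in> E" "(s, t) \<in> E" "(t, p) \<in> E" "(p, s) \<notin> E" "(q, t) \<notin> E"
    and disj: "K \<inter> L = {}"
    and u: "u \<in> V" "u \<notin> K" "u \<notin> L" "card (S u) = 3"
  shows False
proof -
  note sub = affine_blockD(1)[OF K] and sub' = affine_blockD(1)[OF L]
  have "card (S a \<inter> S c) = 1" "card (S b \<inter> S e) = 1"
    using sq sub by (simp_all add: nonadjacent)
  then obtain r r' where r: "S a \<inter> S c = {r}" and r': "S b \<inter> S e = {r'}"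
    by (auto simp: card_1_singleton_iff)
  then have r'': "S c \<inter> S a = {r}" by blast
  have xor: "r \<in> S x \<longleftrightarrow> r' \<notin> S x" if "x \<in> {p, q, s, t, u}" for x
    using square_transversal(1)[OF K sq(1,3-6) r r', of x] that u sub' sq'(1) disj
      affine_blockD(4)[OF L] by blast
  have dj: "S p \<inter> S q = {}" "S q \<inter> S s = {}" "S s \<inter> S t = {}" "S t \<inter> S p = {}"
    using sq' sub' by (simp_all add: adjacent)
  have one: "card (S p \<inter> S s) = 1" "card (S q \<inter> S t) = 1"
    using sq' sub' by (simp_all add: nonadjacent)
  have oneu: "card (S x \<inter> S u) = 1" if "x \<in> L" for x
    using meets_block[OF L that u(1,3)] by (simp add: Int_commute)
  have no: False if "{x, y} \<subseteq> L" "card (S x \<inter> S y) = 1"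
    "r \<in> S x \<and> r \<in> S y \<and> r \<in> S u \<or> r' \<in> S x \<and> r' \<in> S y \<and> r' \<in> S u" for x y
  proof -
    have out: "{x, y, u} \<subseteq> V - K" "card (S x) = 3" "card (S y) = 3" "card (S u) = 3"
      using that u sub' disj affine_blockD(4)[OF L] by auto
    \<comment> \<open>Rotating the 4-cycle exchanges the roles of \<open>r\<close> and \<open>r'\<close>.\<close>
    have K': "K = {b, c, e, a}" using sq(1) by blast
    show False
      using that(3) square_no_three_through_corner[OF K sq(1,3-6) r r' out that(2) oneu oneu]
        square_no_three_through_corner[OF K K' sq(4,5,6,3) r' r'' out that(2) oneu oneu] that(1)
      by blast
  qed
  have "r \<in> S p \<and> r \<in> S s \<and> r' \<in> S q \<and> r' \<in> S t \<or> r' \<in> S p \<and> r' \<in> S s \<and> r \<in> S q \<and> r \<in> S t"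
    using xor[of p] xor[of q] xor[of s] xor[of t] dj by blast
  then show False using no[of p s] no[of q t] one xor[of u] sq'(1) by auto
qed

lemma two_triangles:
  assumes blocks: "affine_block K" "affine_block L" "affine_block M"
    and disj: "K \<inter> L = {}" "K \<inter> M = {}" "L \<inter> M = {}"
  obtains K' L' where "K' \<in> {K, L, M}" "L' \<in> {K, L, M}" "K' \<inter> L' = {}"
    "card K' = 3" "clique K'" "card L' = 3" "clique L'"
proof -
  note found = that
  have two: thesis if X: "affine_block X" "card X \<le> 4" and Y: "affine_block Y" "card Y \<le> 4"
    and Z: "affine_block Z" and dj: "X \<inter> Y = {}" "X \<inter> Z = {}" "Y \<inter> Z = {}"
    and mem: "X \<in> {K, L, M}" "Y \<in> {K, L, M}" for X Y Z
  proof (rule small_block[OF X])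
    assume x: "card X = 3" "clique X" "card rows = 9"
    show thesis
      \<comment> \<open>A 4-cycle would have ten rows, not nine.\<close>
      by (rule small_block[OF Y]) (use x found[OF mem dj(1)] in simp_all)
  next
    fix a b c e
    assume x: "distinct [a, b, c, e]" "X = {a, b, c, e}"
      "(a, b) \<in> E" "(b, c) \<in> E" "(c, e) \<in> E" "(e, a) \<in> E" "(a, c) \<notin> E" "(b, e) \<notin> E"
      "card rows = 10"
    show thesis
    proof (rule small_block[OF Y])
      fix p q s t
      assume y: "distinct [p, q, s, t]" "Y = {p, q, s, t}"
        "(p, q) \<in> E" "(q, s) \<in> E" "(s, t) \<in> E" "(t, p) \<in> E" "(p, s) \<notin> E" "(q, t) \<notin> E"
      obtain u where u: "u \<in> Z" using affine_blockD(3)[OF Z] by blast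
      then have "u \<in> V" "u \<notin> X" "u \<notin> Y" "card (S u) = 3"
        using affine_blockD(1,4)[OF Z] dj by auto
      then have False
        using no_two_squares[OF X(1) x(2,1,3-8) Y(1) y(2,1,3-8) dj(1)] by blast
      then show thesis ..
    qed (use x in simp)
  qed
  have "card L + card M \<le> 9" "card K + card M \<le> 9" "card K + card L \<le> 9"
    using block_sizes[of K L M] block_sizes[of L K M] block_sizes[of M K L] blocks disj
    by (auto simp: Int_commute)
  then consider "card K \<le> 4" "card L \<le> 4" | "card K \<le> 4" "card M \<le> 4" | "card L \<le> 4" "card M \<le> 4"
    by linarith
  then show thesis
    by cases (use two[of K L M] two[of K M L] two[of L M K] blocks disj in \<open>auto simp: Int_commute\<close>)
qed

end

section \<open>Columns as lines of the plane\<close>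

lemma card_image_Int:
  assumes "inj_on f C" "A \<subseteq> C" "B \<subseteq> C"
  shows "card (f ` A \<inter> f ` B) = card (A \<inter> B)"
proof -
  have "f ` A \<inter> f ` B = f ` (A \<inter> B)" using inj_on_image_Int[OF assms] by simp
  moreover have "inj_on f (A \<inter> B)" using inj_on_subset[OF assms(1)] assms(2) by blast
  ultimately show ?thesis by (simp add: card_image)
qed

text \<open>
  An embedding of the graph into the graph of all lines of the affine plane of order 3 in which
  parallel lines are adjacent: \<open>c\<close> is the parallel class, \<open>t\<close> the position within the class.
\<close>

definition plane_labelling :: "'v set \<Rightarrow> 'v rel \<Rightarrow> ('v \<Rightarrow> nat) \<Rightarrow> ('v \<Rightarrow> nat) \<Rightarrow> bool" where
  "plane_labelling V E c t \<longleftrightarrow> (\<forall>i\<in>V. c i < 4 \<and> t i < 3) \<and> inj_on (\<lambda>i. (c i, t i)) V \<and>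
     (\<forall>i\<in>V. \<forall>j\<in>V. i \<noteq> j \<longrightarrow> ((i, j) \<in> E \<longleftrightarrow> c i = c j))"

context column_family
begin

text \<open>
  The triangles \<open>K = {a 0, a 1, a 2}\<close> and \<open>L = {b 0, b 1, b 2}\<close> play the role of the vertical and the
  horizontal lines: \<open>cell (x, y)\<close> is the common row of the columns \<open>S (a x)\<close> and \<open>S (b y)\<close>.
\<close>

lemma columns_are_lines:
  assumes K: "affine_block K" "card K = 3" "clique K"
    and L: "affine_block L" "card L = 3" "clique L"
    and disj: "K \<inter> L = {}"
  obtains cell :: "nat \<times> nat \<Rightarrow> 'r" and c t
  where "inj_on cell grid" "\<And>i. i \<in> V \<Longrightarrow> c i < 4 \<and> t i < (3::nat) \<and> S i = cell ` line (c i) (t i)"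
proof -
  note KV = affine_blockD(1)[OF K(1)] and LV = affine_blockD(1)[OF L(1)]
  obtain a where a: "bij_betw a {..<3::nat} K"
    using ex_bij_betw_nat_finite[OF affine_blockD(2)[OF K(1)]] K(2) by (auto simp: atLeast0LessThan)
  obtain b where b: "bij_betw b {..<3::nat} L"
    using ex_bij_betw_nat_finite[OF affine_blockD(2)[OF L(1)]] L(2) by (auto simp: atLeast0LessThan)
  have aK: "a x \<in> K" if "x < 3" for x using bij_betwE[OF a] that by simp
  have bL: "b x \<in> L" if "x < 3" for x using bij_betwE[OF b] that by simp
  have dja: "S (a x) \<inter> S (a y) = {}" if "x < 3" "y < 3" "x \<noteq> y" for x y
  proof -
    have "a x \<noteq> a y" using bij_betw_imp_inj_on[OF a] that by (auto dest: inj_onD)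
    then have "(a x, a y) \<in> E" using K(3) aK[OF that(1)] aK[OF that(2)] by (auto simp: clique_def)
    then show ?thesis using adjacent aK[OF that(1)] aK[OF that(2)] KV by blast
  qed
  have djb: "S (b x) \<inter> S (b y) = {}" if "x < 3" "y < 3" "x \<noteq> y" for x y
  proof -
    have "b x \<noteq> b y" using bij_betw_imp_inj_on[OF b] that by (auto dest: inj_onD)
    then have "(b x, b y) \<in> E" using L(3) bL[OF that(1)] bL[OF that(2)] by (auto simp: clique_def)
    then show ?thesis using adjacent bL[OF that(1)] bL[OF that(2)] LV by blast
  qed
  have "card (S (a x) \<inter> S (b y)) = 1" if "x < 3" "y < 3" for x y
    using meets_block[OF L(1) bL[OF that(2)], of "a x"] aK[OF that(1)] KV disj by blast
  then have "\<forall>p\<in>grid. \<exists>r. S (a (fst p)) \<inter> S (b (snd p)) = {r}"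
    by (auto simp: grid_def card_1_singleton_iff)
  then obtain cell where cell: "\<And>p. p \<in> grid \<Longrightarrow> S (a (fst p)) \<inter> S (b (snd p)) = {cell p}"
    by metis
  have ina: "cell p \<in> S (a x) \<longleftrightarrow> fst p = x" if p: "p \<in> grid" "x < 3" for p x
  proof -
    have "cell p \<in> S (a (fst p))" using cell[OF p(1)] by blast
    moreover have "fst p < 3" using p(1) by (auto simp: grid_def)
    ultimately show ?thesis using dja[of "fst p" x] p(2) by blast
  qed
  have inb: "cell p \<in> S (b x) \<longleftrightarrow> snd p = x" if p: "p \<in> grid" "x < 3" for p x
  proof -
    have "cell p \<in> S (b (snd p))" using cell[OF p(1)] by blast
    moreover have "snd p < 3" using p(1) by (auto simp: grid_def)
    ultimately show ?thesis using djb[of "snd p" x] p(2) by blast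
  qed
  have inj: "inj_on cell grid"
  proof (rule inj_onI)
    fix p q assume pq: "p \<in> grid" "q \<in> grid" "cell p = cell q"
    then have "fst p < 3" "snd p < 3" by (auto simp: grid_def)
    then show "p = q"
      using ina[OF pq(1), of "fst p"] ina[OF pq(2), of "fst p"] inb[OF pq(1), of "snd p"]
        inb[OF pq(2), of "snd p"] pq(3) by (simp add: prod_eq_iff)
  qed
  have rows: "rows \<subseteq> cell ` grid"
  proof
    fix r assume r: "r \<in> rows"
    obtain v where v: "v \<in> K" "r \<in> S v" using r affine_blockD(5)[OF K(1)] by blast
    obtain w where w: "w \<in> L" "r \<in> S w" using r affine_blockD(5)[OF L(1)] by blast
    obtain x y where xy: "x < 3" "v = a x" "y < 3" "w = b y"
      using v(1) w(1) bij_betw_imp_surj_on[OF a] bij_betw_imp_surj_on[OF b] by auto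
    then have "r \<in> S (a (fst (x, y))) \<inter> S (b (snd (x, y)))" using v w by simp
    moreover have g: "(x, y) \<in> grid" using xy by (simp add: grid_def)
    ultimately show "r \<in> cell ` grid" unfolding cell[OF g] using g by blast
  qed
  have "\<exists>c t. c < 4 \<and> t < 3 \<and> S i = cell ` line c t" if i: "i \<in> V" for i
  proof -
    define T where "T = {p \<in> grid. cell p \<in> S i}"
    have S: "S i = cell ` T" using rows i by (auto simp: T_def rows_def)
    have "\<exists>c t. c < 4 \<and> t < 3 \<and> T = line c t"
    proof -
      consider x where "x < 3" "i = a x" | y where "y < 3" "i = b y" | "i \<notin> K" "i \<notin> L"
        using bij_betw_imp_surj_on[OF a] bij_betw_imp_surj_on[OF b] by (metis imageE lessThan_iff)
      then show ?thesis
      proof cases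
        case 1
        then have "T = line 0 x" using ina by (auto simp: T_def line_def slope_def)
        then show ?thesis using 1 by (intro exI[of _ 0] exI[of _ x]) simp
      next
        case 2
        then have "T = line 1 y" using inb by (auto simp: T_def line_def slope_def)
        then show ?thesis using 2 by (intro exI[of _ 1] exI[of _ y]) simp
      next
        case 3
        have unique: "\<exists>!p. p \<in> T \<and> p \<in> line k x"
          if col: "card (S i \<inter> S v) = 1" and line: "\<And>p. p \<in> grid \<Longrightarrow> cell p \<in> S v \<longleftrightarrow> p \<in> line k x" for v k x
        proof -
          obtain r where r: "S i \<inter> S v = {r}" using col by (rule card_1_singletonE)
          then have "r \<in> rows" using i by (auto simp: rows_def)
          then obtain p where p: "p \<in> grid" "r = cell p" using rows by blast
          show ?thesis
          proof
            show "p \<in> T \<and> p \<in> line k x" using r p line[OF p(1)] by (auto simp: T_def)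
          next
            fix q assume q: "q \<in> T \<and> q \<in> line k x"
            then have "q \<in> grid" "cell q \<in> S i \<inter> S v" using line by (auto simp: T_def)
            then show "q = p" using r p inj by (auto dest: inj_onD)
          qed
        qed
        have "T \<subseteq> grid" by (auto simp: T_def)
        moreover have "\<exists>!p. p \<in> T \<and> p \<in> line 0 x" if "x < 3" for x
          using meets_block[OF K(1) aK[OF that] i 3(1)]
          by (rule unique) (use ina that in \<open>auto simp: line_def slope_def\<close>)
        moreover have "\<exists>!p. p \<in> T \<and> p \<in> line 1 y" if "y < 3" for y
          using meets_block[OF L(1) bL[OF that] i 3(2)]
          by (rule unique) (use inb that in \<open>auto simp: line_def slope_def\<close>)
        ultimately obtain c t where "c \<in> {2, 3}" "t < 3" "T = line c t"
          by (rule transversal_is_line)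
        then show ?thesis by (intro exI[of _ c] exI[of _ t]) auto
      qed
    qed
    then show ?thesis unfolding S by blast
  qed
  then obtain c t where "\<And>i. i \<in> V \<Longrightarrow> c i < 4 \<and> t i < (3::nat) \<and> S i = cell ` line (c i) (t i)"
    by metis
  then show thesis using that inj by blast
qed

lemma three_blocks_plane_labelling:
  assumes blocks: "affine_block K" "affine_block L" "affine_block M"
    and disj: "K \<inter> L = {}" "K \<inter> M = {}" "L \<inter> M = {}"
  shows "\<forall>i\<in>V. card (S i) = 3" and "\<exists>c t. plane_labelling V E c t"
proof -
  obtain K' L' where KL: "K' \<in> {K, L, M}" "L' \<in> {K, L, M}" "K' \<inter> L' = {}"
    "card K' = 3" "clique K'" "card L' = 3" "clique L'"
    using two_triangles[OF blocks disj] by blast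
  then have "affine_block K'" "affine_block L'" using blocks by auto
  then obtain cell :: "nat \<times> nat \<Rightarrow> 'r" and c t where inj: "inj_on cell grid"
    and ct: "\<And>i. i \<in> V \<Longrightarrow> c i < 4 \<and> t i < (3::nat) \<and> S i = cell ` line (c i) (t i)"
    using KL columns_are_lines[of K' L'] by metis
  have sub: "line k x \<subseteq> grid" for k x by (auto simp: line_def)
  show card3: "\<forall>i\<in>V. card (S i) = 3"
    using ct card_line inj_on_subset[OF inj sub] by (simp add: card_image)
  have meet: "card (S i \<inter> S j) = card (line (c i) (t i) \<inter> line (c j) (t j))" if "i \<in> V" "j \<in> V" for i j
    using card_image_Int[OF inj sub sub] ct[OF that(1)] ct[OF that(2)] by simp
  have differ: "(c i, t i) \<noteq> (c j, t j)" if ij: "i \<in> V" "j \<in> V" "i \<noteq> j" for i j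
  proof
    assume "(c i, t i) = (c j, t j)"
    then have "S i = S j" using ct ij by simp
    then show False using card_Int_columns[OF ij] bspec[OF card3 ij(1)] by simp
  qed
  have "(i, j) \<in> E \<longleftrightarrow> c i = c j" if ij: "i \<in> V" "j \<in> V" "i \<noteq> j" for i j
  proof
    assume "(i, j) \<in> E"
    then have "card (S i \<inter> S j) = 0" using adjacent ij by simp
    then show "c i = c j" using meet[OF ij(1,2)] card_line_Int ct[OF ij(1)] ct[OF ij(2)] by fastforce
  next
    assume eq: "c i = c j"
    then have "t i \<noteq> t j" using differ[OF ij] by simp
    then have "card (S i \<inter> S j) = 0" using meet[OF ij(1,2)] line_Int_parallel eq by simp
    then show "(i, j) \<in> E" using nonadjacent[OF ij] by linarith
  qed
  then have "plane_labelling V E c t"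
    using ct differ unfolding plane_labelling_def inj_on_def by blast
  then show "\<exists>c t. plane_labelling V E c t" by blast
qed

end

section \<open>Connected components and parallel classes\<close>

lemma plane_labellingD:
  assumes "plane_labelling V E c t"
  shows "i \<in> V \<Longrightarrow> c i < 4" "i \<in> V \<Longrightarrow> t i < 3"
    and "i \<in> V \<Longrightarrow> j \<in> V \<Longrightarrow> i \<noteq> j \<Longrightarrow> (i, j) \<in> E \<longleftrightarrow> c i = c j"
    and "i \<in> V \<Longrightarrow> j \<in> V \<Longrightarrow> c i = c j \<Longrightarrow> t i = t j \<Longrightarrow> i = j"
  using assms unfolding plane_labelling_def inj_on_def by auto

locale nat_pair_graph = pair_graph G for G :: "nat pair_pre_digraph"
begin

lemma components_nonempty: "K \<in> components G \<Longrightarrow> K \<noteq> {}"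
  unfolding components_def in_sccs_verts_conv_reachable by blast

lemma components_subset: "K \<in> components G \<Longrightarrow> K \<subseteq> pverts G"
  using sccs_verts_subsets unfolding components_def by simp

lemma finite_component: "K \<in> components G \<Longrightarrow> finite K"
  using components_subset pair_finite_verts finite_subset by blast

lemma finite_components: "finite (components G)"
  using finite_sccs_verts unfolding components_def by simp

lemma components_disjoint: "K \<in> components G \<Longrightarrow> L \<in> components G \<Longrightarrow> K \<noteq> L \<Longrightarrow> K \<inter> L = {}"
  unfolding components_def by (rule sccs_verts_disjoint)

lemma component_of: "v \<in> pverts G \<Longrightarrow> \<exists>K\<in>components G. v \<in> K"
  using scc_of_in_sccs_verts[of v] unfolding components_def
  by (intro bexI[of _ "scc_of v"]) (auto simp: scc_of_def)

lemma arc_in_component: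
  assumes K: "K \<in> components G" "u \<in> K" and uv: "(u, v) \<in> parcs G"
  shows "v \<in> K"
proof (rule ccontr)
  assume "v \<notin> K"
  moreover have "u \<rightarrow>\<^sup>*\<^bsub>with_proj G\<^esub> v" using uv by (rule reachable_adjI)
  moreover have "v \<rightarrow>\<^sup>*\<^bsub>with_proj G\<^esub> u" using arcs_symmetric[OF uv] by (rule reachable_adjI)
  moreover have "\<forall>u\<in>K. \<forall>v. v \<notin> K \<longrightarrow> \<not> u \<rightarrow>\<^sup>*\<^bsub>with_proj G\<^esub> v \<or> \<not> v \<rightarrow>\<^sup>*\<^bsub>with_proj G\<^esub> u"
    using K(1) unfolding components_def in_sccs_verts_conv_reachable by (elim conjE)
  ultimately show False using K(2) by metis
qed

text \<open>
  Connectedness of a component in the form in which it is used: a property that passes along edges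
  holds throughout the component.
\<close>

lemma component_induct:
  assumes K: "K \<in> components G" "u \<in> K" "v \<in> K" and P: "P u"
    and step: "\<And>x y. (x, y) \<in> parcs G \<Longrightarrow> P x \<Longrightarrow> P y"
  shows "P v"
proof -
  have "\<forall>u\<in>K. \<forall>v\<in>K. u \<rightarrow>\<^sup>*\<^bsub>with_proj G\<^esub> v"
    using K(1) unfolding components_def in_sccs_verts_conv_reachable by (elim conjE)
  then have "u \<rightarrow>\<^sup>*\<^bsub>with_proj G\<^esub> v" using K(2,3) by (metis (no_types))
  then have "(u, v) \<in> rtrancl_on (pverts G) (parcs G)" by (simp only: reachable_def with_proj_simps)
  then show ?thesis by (induction rule: rtrancl_on_induct) (use P step in blast)+
qed

lemma component_labelling:
  assumes lab: "plane_labelling (pverts G) (parcs G) c t"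
    and K: "K \<in> components G" "u \<in> K" "v \<in> K"
  shows "c u = c v"
proof -
  have "c v = c u"
  proof (rule component_induct[OF K, of "\<lambda>w. c w = c u"])
    fix x y assume xy: "(x, y) \<in> parcs G" "c x = c u"
    moreover have "x \<in> pverts G" "y \<in> pverts G" "x \<noteq> y" using xy(1) in_arcsD1 in_arcsD2 no_loops' by blast+
    ultimately show "c y = c u" using lab unfolding plane_labelling_def by metis
  qed simp
  then show ?thesis ..
qed

lemma card_component_le_3:
  assumes lab: "plane_labelling (pverts G) (parcs G) c t" and K: "K \<in> components G"
  shows "card K \<le> 3" and "inj_on t K" and "t ` K \<subseteq> {..<3}"
proof -
  have V: "K \<subseteq> pverts G" using components_subset[OF K] .
  show "inj_on t K"
  proof (rule inj_onI)
    fix u v assume uv: "u \<in> K" "v \<in> K" "t u = t v"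
    then have "c u = c v" using component_labelling[OF lab K] by blast
    then show "u = v" using plane_labellingD(4)[OF lab] uv V by auto
  qed
  moreover show "t ` K \<subseteq> {..<3}" using plane_labellingD(2)[OF lab] V by auto
  ultimately show "card K \<le> 3" using card_inj_on_le[of t K "{..<3}"] by simp
qed

lemma component_clique:
  assumes lab: "plane_labelling (pverts G) (parcs G) c t" and K: "K \<in> components G"
    and "u \<in> K" "v \<in> K" "u \<noteq> v"
  shows "(u, v) \<in> parcs G"
  using assms component_labelling[OF lab K, of u v] components_subset[OF K]
    plane_labellingD(3)[OF lab, of u v] by auto

text \<open>
  The parallel class is constant on each component, and it separates components since vertices of the
  same class are adjacent.
\<close>

lemma card_components_le_4:
  assumes lab: "plane_labelling (pverts G) (parcs G) c t"
  shows "card (components G) \<le> 4"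
proof -
  let ?f = "\<lambda>K. c (SOME u. u \<in> K)"
  have some: "(SOME u. u \<in> K) \<in> K" if "K \<in> components G" for K
    using components_nonempty[OF that] by (rule some_in_eq[THEN iffD2])
  have "inj_on ?f (components G)"
  proof (rule inj_onI, rule ccontr)
    fix K L assume KL: "K \<in> components G" "L \<in> components G" "?f K = ?f L" "K \<noteq> L"
    obtain u v where uv: "u = (SOME u. u \<in> K)" "v = (SOME u. u \<in> L)" by simp
    then have mem: "u \<in> K" "v \<in> L" "c u = c v" using some KL(1-3) by simp_all
    then have ne: "u \<noteq> v" "v \<notin> K" using components_disjoint[OF KL(1,2,4)] by auto
    moreover have "u \<in> pverts G" "v \<in> pverts G"
      using components_subset[OF KL(1)] components_subset[OF KL(2)] mem by auto
    ultimately have "(u, v) \<in> parcs G" using plane_labellingD(3)[OF lab] mem(3) by simp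
    then show False using arc_in_component[OF KL(1) mem(1)] ne(2) by simp
  qed
  moreover have "?f ` components G \<subseteq> {..<4}"
    using plane_labellingD(1)[OF lab] subsetD[OF components_subset some] by auto
  ultimately show ?thesis using card_inj_on_le[of ?f _ "{..<4}"] by simp
qed

text \<open>
  Distinct vertices are adjacent exactly if they lie in the same component. Hence any injections of
  the components into the four parallel classes and of each component into the three positions of
  a class will do.
\<close>

lemma plane_labelling_if_small_cliques:
  assumes few: "card (components G) \<le> 4" and small: "\<And>K. K \<in> components G \<Longrightarrow> card K \<le> 3"
    and clique: "\<And>K u v. K \<in> components G \<Longrightarrow> u \<in> K \<Longrightarrow> v \<in> K \<Longrightarrow> u \<noteq> v \<Longrightarrow> (u, v) \<in> parcs G"
  shows "\<exists>c t. plane_labelling (pverts G) (parcs G) c t"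
proof -
  obtain f :: "nat set \<Rightarrow> nat" where f: "inj_on f (components G)" "f ` components G \<subseteq> {..<4}"
    using few finite_components card_le_inj[of "components G" "{..<4::nat}"] by auto
  have "\<forall>K\<in>components G. \<exists>g :: nat \<Rightarrow> nat. g ` K \<subseteq> {..<3} \<and> inj_on g K"
    using small finite_component card_le_inj[of _ "{..<3::nat}"] by auto
  then obtain g :: "nat set \<Rightarrow> nat \<Rightarrow> nat"
    where g: "\<And>K. K \<in> components G \<Longrightarrow> g K ` K \<subseteq> {..<3} \<and> inj_on (g K) K" by metis
  obtain C where C: "\<And>v. v \<in> pverts G \<Longrightarrow> C v \<in> components G \<and> v \<in> C v"
    using component_of by metis
  have "plane_labelling (pverts G) (parcs G) (\<lambda>v. f (C v)) (\<lambda>v. g (C v) v)"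
    unfolding plane_labelling_def
  proof (intro conjI ballI impI)
    fix v assume v: "v \<in> pverts G"
    show "f (C v) < 4" "g (C v) v < 3" using C[OF v] f(2) g[of "C v"] by auto
  next
    show "inj_on (\<lambda>v. (f (C v), g (C v) v)) (pverts G)"
    proof (rule inj_onI)
      fix u v assume uv: "u \<in> pverts G" "v \<in> pverts G" "(f (C u), g (C u) u) = (f (C v), g (C v) v)"
      then have "C u = C v" using f(1) C by (auto dest: inj_onD)
      then show "u = v" using uv C[OF uv(1)] C[OF uv(2)] g[of "C v"] by (auto dest: inj_onD)
    qed
  next
    fix u v assume uv: "u \<in> pverts G" "v \<in> pverts G" "u \<noteq> v"
    show "(u, v) \<in> parcs G \<longleftrightarrow> f (C u) = f (C v)"
    proof
      assume "(u, v) \<in> parcs G"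
      then have "v \<in> C u \<inter> C v" using arc_in_component[of "C u" u v] C uv by simp
      then have "C u = C v" using components_disjoint[of "C u" "C v"] C uv by auto
      then show "f (C u) = f (C v)" by simp
    next
      assume "f (C u) = f (C v)"
      then have "C u = C v" using f(1) C uv by (auto dest: inj_onD)
      then show "(u, v) \<in> parcs G" using clique[of "C v" u v] C uv by metis
    qed
  qed
  then show ?thesis by blast
qed

end

section \<open>The matrix of a component\<close>

lemma bij_betw_pick:
  assumes "finite K"
  shows "bij_betw (pick K) {..<card K} K"
proof -
  have "inj_on (pick K) {..<card K}"
    by (rule inj_onI) (metis card_pick_le lessThan_iff)
  moreover have "pick K ` {..<card K} \<subseteq> K" using pick_in_set_le by blast
  ultimately show ?thesis
    using assms by (simp add: bij_betw_def card_image card_subset_eq)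
qed

text \<open>
  The matrix of a complete graph with all labels 2: the Cartan matrix of type \<open>A\<^sub>1\<close> and \<open>A\<^sub>2\<close> for
  \<open>k = 1, 2\<close>, and of type \<open>A\<^sub>2\<^sup>(\<^sup>1\<^sup>)\<close> for \<open>k = 3\<close>.
\<close>

definition clique_mat :: "nat \<Rightarrow> real mat" where
  "clique_mat k = mat k k (\<lambda>(i, j). if i = j then 2 else -1)"

lemma clique_mat_3: "clique_mat 3 = cartan_A2"
proof (rule eq_matI)
  fix i j assume "i < dim_row cartan_A2" "j < dim_col cartan_A2"
  then have "i < 3" "j < 3" by (simp_all add: cartan_A2_def mat_of_rows_list_def)
  then show "clique_mat 3 $$ (i, j) = cartan_A2 $$ (i, j)"
    by (elim less_3_cases) (simp_all add: clique_mat_def cartan_A2_def mat_of_rows_list_def)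
qed (simp_all add: clique_mat_def cartan_A2_def mat_of_rows_list_def)

lemma principal_submatrix_cartan_A2_iff:
  "principal_submatrix B cartan_A2 \<longleftrightarrow> (\<exists>k\<le>3. B = clique_mat k)"
proof -
  have sub: "submatrix cartan_A2 I I = clique_mat (card I)" if I: "I \<subseteq> {0..<3}" for I
  proof -
    have fin: "finite I" using I finite_subset by blast
    have "{i. i < 3 \<and> i \<in> I} = I" using I by auto
    moreover have "pick I i < 3" if "i < card I" for i
      using pick_in_set_le[OF that] I by auto
    moreover have "pick I i = pick I j \<longleftrightarrow> i = j" if "i < card I" "j < card I" for i j
      using bij_betw_imp_inj_on[OF bij_betw_pick[OF fin]] that by (auto dest: inj_onD)
    ultimately show ?thesis
      unfolding clique_mat_3[symmetric] by (intro eq_matI) (simp_all add: submatrix_def clique_mat_def)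
  qed
  have dim: "dim_row cartan_A2 = 3" by (simp add: cartan_A2_def mat_of_rows_list_def)
  show ?thesis
  proof
    assume "principal_submatrix B cartan_A2"
    then obtain I where "I \<subseteq> {0..<3}" "B = submatrix cartan_A2 I I"
      unfolding principal_submatrix_def dim by blast
    moreover from this have "card I \<le> 3" using card_mono[of "{0..<3}" I] by simp
    ultimately show "\<exists>k\<le>3. B = clique_mat k" using sub by blast
  next
    assume "\<exists>k\<le>3. B = clique_mat k"
    then obtain k where "k \<le> 3" "B = clique_mat k" by blast
    then show "principal_submatrix B cartan_A2"
      unfolding principal_submatrix_def dim using sub[of "{0..<k}"] by (intro exI[of _ "{0..<k}"]) simp
  qed
qed

lemma finite_type_clique_mat:
  assumes "k \<le> 2"
  shows "finite_type (clique_mat k)"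
  unfolding finite_type_def positive_definite_def
proof (intro ballI impI)
  fix v :: "real vec"
  assume v: "v \<in> carrier_vec (dim_row (clique_mat k))" "v \<noteq> 0\<^sub>v (dim_row (clique_mat k))"
  have dim: "dim_vec v = k" using v(1) by (simp add: clique_mat_def)
  consider "k = 0" | "k = 1" | "k = 2" using assms by linarith
  then show "v \<bullet> (clique_mat k *\<^sub>v v) > 0"
  proof cases
    case 1
    then show ?thesis using v(2) dim by (auto simp: clique_mat_def)
  next
    case 2
    then have "v $ 0 \<noteq> 0" using v(2) dim by (auto simp: clique_mat_def)
    moreover have "v \<bullet> (clique_mat k *\<^sub>v v) = 2 * (v $ 0)\<^sup>2"
      using 2 dim by (simp add: clique_mat_def scalar_prod_def power2_eq_square)
    ultimately show ?thesis by simp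
  next
    case 3
    have "v $ 0 \<noteq> 0 \<or> v $ 1 \<noteq> 0"
    proof (rule ccontr)
      assume "\<not> (v $ 0 \<noteq> 0 \<or> v $ 1 \<noteq> 0)"
      then have "v = 0\<^sub>v k" using 3 dim by (intro eq_vecI) (auto simp: less_2_cases_iff)
      then show False using v(2) by (simp add: clique_mat_def)
    qed
    then have "0 < (v $ 0)\<^sup>2 + (v $ 1)\<^sup>2 + (v $ 0 - v $ 1)\<^sup>2"
      by (metis add_nonneg_nonneg add_pos_nonneg add_nonneg_pos zero_less_power2 zero_le_power2)
    moreover have "v \<bullet> (clique_mat k *\<^sub>v v) = (v $ 0)\<^sup>2 + (v $ 1)\<^sup>2 + (v $ 0 - v $ 1)\<^sup>2"
      using 3 dim by (simp add: clique_mat_def scalar_prod_def power2_eq_square numeral_2_eq_2 algebra_simps)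
    ultimately show ?thesis by simp
  qed
qed

lemma affine_type_null_vector:
  assumes "affine_type A"
  obtains \<delta> where "\<delta> \<in> carrier_vec (dim_row A)" "\<And>i. i < dim_row A \<Longrightarrow> \<delta> $ i > 0"
    "A *\<^sub>v \<delta> = 0\<^sub>v (dim_row A)"
proof -
  obtain \<delta> where d: "\<delta> \<in> carrier_vec (dim_row A)" "\<forall>i < dim_row A. \<delta> $ i > 0"
    "mat_kernel A = range (\<lambda>c. c \<cdot>\<^sub>v \<delta>)"
    using assms unfolding affine_type_def by blast
  have "1 \<cdot>\<^sub>v \<delta> \<in> mat_kernel A" unfolding d(3) by blast
  then have "A *\<^sub>v \<delta> = 0\<^sub>v (dim_row A)" by (simp add: mat_kernel_def)
  then show thesis using that d by auto
qed

lemma affine_not_finite: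
  assumes "affine_type A" "dim_row A > 0"
  shows "\<not> finite_type A"
proof
  assume fin: "finite_type A"
  obtain \<delta> where d: "\<delta> \<in> carrier_vec (dim_row A)" "\<And>i. i < dim_row A \<Longrightarrow> \<delta> $ i > 0"
    "A *\<^sub>v \<delta> = 0\<^sub>v (dim_row A)"
    using affine_type_null_vector[OF assms(1)] by metis
  have "\<delta> \<noteq> 0\<^sub>v (dim_row A)" using d(2)[OF assms(2)] assms(2) by auto
  then have "\<delta> \<bullet> (A *\<^sub>v \<delta>) > 0" using fin d(1) unfolding finite_type_def positive_definite_def by blast
  then show False using d(1,3) by simp
qed

lemma component_mat_index:
  assumes "K \<subseteq> {0..<N}"
  shows "dim_row (component_mat (Q_mat N m G) K) = card K"
    and "dim_col (component_mat (Q_mat N m G) K) = card K"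
    and "i < card K \<Longrightarrow> j < card K \<Longrightarrow> component_mat (Q_mat N m G) K $$ (i, j) =
      (if i = j then real (m (pick K i)) else if (pick K i, pick K j) \<in> parcs G then - 1 else 0)"
proof -
  have eq: "{i. i < N \<and> i \<in> K} = K" using assms by auto
  have fin: "finite K" using assms finite_subset by blast
  show "dim_row (component_mat (Q_mat N m G) K) = card K" "dim_col (component_mat (Q_mat N m G) K) = card K"
    by (simp_all add: component_mat_def dim_submatrix Q_mat_def eq)
  assume ij: "i < card K" "j < card K"
  have "pick K i < N" "pick K j < N" using pick_in_set_le[OF ij(1)] pick_in_set_le[OF ij(2)] assms by auto
  moreover have "pick K i = pick K j \<longleftrightarrow> i = j"
    using bij_betw_imp_inj_on[OF bij_betw_pick[OF fin]] ij by (auto dest: inj_onD)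
  ultimately show "component_mat (Q_mat N m G) K $$ (i, j) =
      (if i = j then real (m (pick K i)) else if (pick K i, pick K j) \<in> parcs G then - 1 else 0)"
    using ij by (simp add: component_mat_def submatrix_def Q_mat_def eq)
qed

lemma component_mat_eq_clique_mat_iff:
  assumes K: "K \<subseteq> {0..<N}"
  shows "component_mat (Q_mat N m G) K = clique_mat k \<longleftrightarrow>
    k = card K \<and> (\<forall>v\<in>K. m v = 2) \<and> (\<forall>u\<in>K. \<forall>v\<in>K. u \<noteq> v \<longrightarrow> (u, v) \<in> parcs G)"
proof -
  note index = component_mat_index[OF K, where m = m and G = G]
  have fin: "finite K" using assms finite_subset by blast
  note bij = bij_betw_pick[OF fin]
  show ?thesis
  proof
    assume eq: "component_mat (Q_mat N m G) K = clique_mat k"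
    then have k: "k = card K" using index(1) by (simp add: clique_mat_def)
    have "m v = 2" if "v \<in> K" for v
    proof -
      obtain i where i: "i < card K" "v = pick K i" using bij_betw_imp_surj_on[OF bij] \<open>v \<in> K\<close> by auto
      then have "real (m v) = clique_mat k $$ (i, i)" using index(3)[of i i] eq by simp
      then show ?thesis using i k by (simp add: clique_mat_def)
    qed
    moreover have "(u, v) \<in> parcs G" if uv: "u \<in> K" "v \<in> K" "u \<noteq> v" for u v
    proof -
      obtain i j where ij: "i < card K" "u = pick K i" "j < card K" "v = pick K j"
        using bij_betw_imp_surj_on[OF bij] uv by (metis imageE lessThan_iff)
      then have "i \<noteq> j" using uv by auto
      then have "(if (u, v) \<in> parcs G then - 1 else 0) = clique_mat k $$ (i, j)"
        using index(3)[of i j] eq ij by simp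
      then show ?thesis using ij k \<open>i \<noteq> j\<close> by (simp add: clique_mat_def split: if_splits)
    qed
    ultimately show "k = card K \<and> (\<forall>v\<in>K. m v = 2) \<and> (\<forall>u\<in>K. \<forall>v\<in>K. u \<noteq> v \<longrightarrow> (u, v) \<in> parcs G)"
      using k by blast
  next
    assume R: "k = card K \<and> (\<forall>v\<in>K. m v = 2) \<and> (\<forall>u\<in>K. \<forall>v\<in>K. u \<noteq> v \<longrightarrow> (u, v) \<in> parcs G)"
    show "component_mat (Q_mat N m G) K = clique_mat k"
    proof (rule eq_matI)
      fix i j assume "i < dim_row (clique_mat k)" "j < dim_col (clique_mat k)"
      then have ij: "i < card K" "j < card K" using R by (simp_all add: clique_mat_def)
      have "pick K i \<in> K" "pick K j \<in> K" using ij by (simp_all add: pick_in_set_le)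
      moreover have "i \<noteq> j \<Longrightarrow> pick K i \<noteq> pick K j"
        using bij_betw_imp_inj_on[OF bij] ij by (auto dest: inj_onD)
      ultimately show "component_mat (Q_mat N m G) K $$ (i, j) = clique_mat k $$ (i, j)"
        using index(3)[OF ij] ij R by (simp add: clique_mat_def)
    qed (use index R in \<open>simp_all add: clique_mat_def\<close>)
  qed
qed

text \<open>
  The null vector of the submatrix is indexed by positions in \<open>K\<close>; transporting it along \<open>pick K\<close> gives
  a function on the vertices themselves.
\<close>

lemma affine_cartan_null_vector:
  assumes K: "K \<subseteq> {0..<N}" "K \<noteq> {}" and irr: "irrefl (parcs G)"
    and A: "affine_cartan (component_mat (Q_mat N m G) K)"
  shows "\<forall>v\<in>K. m v = 2"
    and "\<exists>d :: nat \<Rightarrow> real. \<forall>v\<in>K. d v > 0 \<and> 2 * d v = (\<Sum>w \<in> {w \<in> K. (v, w) \<in> parcs G}. d w)"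
    and "\<not> finite_type (component_mat (Q_mat N m G) K)"
proof -
  let ?A = "component_mat (Q_mat N m G) K"
  note index = component_mat_index[OF K(1), where m = m and G = G]
  have fin: "finite K" using K finite_subset by blast
  note bij = bij_betw_pick[OF fin]
  have surj: "\<exists>i<card K. v = pick K i" if "v \<in> K" for v
    using bij_betw_imp_surj_on[OF bij] that by auto
  have aff: "affine_type ?A" and diag: "\<And>i. i < card K \<Longrightarrow> ?A $$ (i, i) = 2"
    using A index(1) unfolding affine_cartan_def by auto
  show m2: "\<forall>v\<in>K. m v = 2"
  proof
    fix v assume "v \<in> K"
    then obtain i where "i < card K" "v = pick K i" using surj by blast
    then show "m v = 2" using diag[of i] index(3)[of i i] by simp
  qed
  show "\<not> finite_type ?A" using affine_not_finite[OF aff] index(1) K fin by (simp add: card_gt_0_iff)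
  obtain \<delta> where d: "\<delta> \<in> carrier_vec (card K)" "\<And>i. i < card K \<Longrightarrow> \<delta> $ i > 0"
    "?A *\<^sub>v \<delta> = 0\<^sub>v (card K)"
    using affine_type_null_vector[OF aff] unfolding index(1) by metis
  define d where "d v = \<delta> $ (the_inv_into {..<card K} (pick K) v)" for v
  have dpick: "d (pick K i) = \<delta> $ i" if "i < card K" for i
    using the_inv_into_f_f[OF bij_betw_imp_inj_on[OF bij]] that by (simp add: d_def)
  have "d v > 0 \<and> 2 * d v = (\<Sum>w \<in> {w \<in> K. (v, w) \<in> parcs G}. d w)" if v: "v \<in> K" for v
  proof -
    obtain i where i: "i < card K" "v = pick K i" using surj v by blast
    have "0 = (?A *\<^sub>v \<delta>) $ i" using d(3) i by simp
    also have "\<dots> = (\<Sum>j<card K. ?A $$ (i, j) * \<delta> $ j)"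
      using i d(1) index(1,2) by (auto simp: scalar_prod_def row_def atLeast0LessThan intro!: sum.cong)
    also have "\<dots> = (\<Sum>j<card K. (if v = pick K j then 2 * d v else 0) -
        (if (v, pick K j) \<in> parcs G then d (pick K j) else 0))"
    proof (rule sum.cong[OF refl])
      fix j assume "j \<in> {..<card K}"
      then have j: "j < card K" by simp
      have "v = pick K j \<longleftrightarrow> i = j"
        using bij_betw_imp_inj_on[OF bij] i j by (auto dest: inj_onD)
      then show "?A $$ (i, j) * \<delta> $ j = (if v = pick K j then 2 * d v else 0) -
        (if (v, pick K j) \<in> parcs G then d (pick K j) else 0)"
        using index(3)[OF i(1) j] i dpick[OF j] m2 v irr by (auto simp: irrefl_def)
    qed
    also have "\<dots> = (\<Sum>w\<in>K. (if v = w then 2 * d v else 0) - (if (v, w) \<in> parcs G then d w else 0))"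
      by (rule sum.reindex_bij_betw[OF bij])
    also have "\<dots> = 2 * d v - (\<Sum>w \<in> {w \<in> K. (v, w) \<in> parcs G}. d w)"
      using v fin by (simp add: sum_subtractf sum.inter_filter)
    finally show ?thesis using d(2)[OF i(1)] dpick[OF i(1)] i(2) by simp
  qed
  then show "\<exists>d :: nat \<Rightarrow> real. \<forall>v\<in>K. d v > 0 \<and> 2 * d v = (\<Sum>w \<in> {w \<in> K. (v, w) \<in> parcs G}. d w)"
    by blast
qed

section \<open>Realizations\<close>

definition column_support :: "real mat \<Rightarrow> nat \<Rightarrow> nat set" where
  "column_support J j = {r. r < dim_row J \<and> J $$ (r, j) = 1}"

lemma zero_one_entry:
  assumes "elements_mat J \<subseteq> {0, 1 :: real}" "i < dim_row J" "j < dim_col J"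
  shows "J $$ (i, j) = 0 \<or> J $$ (i, j) = 1"
proof -
  have "J $$ (i, j) \<in> elements_mat J" using assms(2,3) by (intro elements_matI[of J "dim_row J" "dim_col J"]) auto
  then show ?thesis using assms(1) by blast
qed

text \<open>
  The bridge between matrices and set systems: for a 0-1 matrix, \<open>J\<^sup>t J\<close> counts common rows of
  columns.
\<close>

lemma gram_entry:
  assumes J: "elements_mat J \<subseteq> {0, 1}" and ij: "i < dim_col J" "j < dim_col J"
  shows "(transpose_mat J * J) $$ (i, j) = real (card (column_support J i \<inter> column_support J j))"
proof -
  have "(transpose_mat J * J) $$ (i, j) = (\<Sum>r<dim_row J. J $$ (r, i) * J $$ (r, j))"
    using ij by (simp add: scalar_prod_def atLeast0LessThan)
  also have "\<dots> = (\<Sum>r<dim_row J. if r \<in> column_support J i \<inter> column_support J j then 1 else 0)"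
  proof (rule sum.cong[OF refl])
    fix r assume "r \<in> {..<dim_row J}"
    then have r: "r < dim_row J" by simp
    have "J $$ (r, i) = 0 \<or> J $$ (r, i) = 1" "J $$ (r, j) = 0 \<or> J $$ (r, j) = 1"
      using zero_one_entry[OF J r] ij by blast+
    then show "J $$ (r, i) * J $$ (r, j) =
        (if r \<in> column_support J i \<inter> column_support J j then 1 else 0)"
      using r by (auto simp: column_support_def)
  qed
  also have "\<dots> = (\<Sum>r \<in> {r \<in> {..<dim_row J}. r \<in> column_support J i \<inter> column_support J j}. 1)"
    by (rule sum.inter_filter[symmetric]) simp
  also have "{r \<in> {..<dim_row J}. r \<in> column_support J i \<inter> column_support J j} =
      column_support J i \<inter> column_support J j"
    by (auto simp: column_support_def)
  finally show ?thesis by simp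
qed

lemma row_submatrix_zero_iff:
  assumes K: "K \<subseteq> {0..<dim_col J}" and i: "i < dim_row J"
  shows "row (submatrix J UNIV K) i = 0\<^sub>v (card K) \<longleftrightarrow> (\<forall>v\<in>K. J $$ (i, v) = 0)"
proof -
  have eq: "{j. j < dim_col J \<and> j \<in> K} = K" using K by auto
  have "finite K" using K finite_subset by blast
  then have img: "K = pick K ` {..<card K}" using bij_betw_imp_surj_on[OF bij_betw_pick] by simp
  have "row (submatrix J UNIV K) i = 0\<^sub>v (card K) \<longleftrightarrow> (\<forall>j<card K. J $$ (i, pick K j) = 0)"
    using i by (simp add: submatrix_def vec_eq_iff row_def eq pick_UNIV)
  also have "\<dots> \<longleftrightarrow> (\<forall>v\<in>K. J $$ (i, v) = 0)" by (subst (2) img) auto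
  finally show ?thesis .
qed

context nat_pair_graph
begin

lemma realization_column_family:
  assumes V: "pverts G = {0..<N}" and J: "realization G (Q_mat N m G) J"
  shows "column_family (pverts G) (parcs G) (column_support J)"
    and "j < N \<Longrightarrow> card (column_support J j) = m j + 1"
    and "K \<in> components G \<Longrightarrow> \<not> finite_type (component_mat (Q_mat N m G) K) \<Longrightarrow>
      (\<Union>v\<in>pverts G. column_support J v) = (\<Union>v\<in>K. column_support J v)"
proof -
  have dimQ: "dim_row (Q_mat N m G) = N" by (simp add: Q_mat_def)
  note R = J[unfolded realization_def dimQ]
  have dim: "dim_col J = N" using R by (rule conjunct1)
  have J01: "elements_mat J \<subseteq> {0, 1}" using R by (elim conjE)
  have cover: "\<forall>K \<in> components G. \<not> finite_type (component_mat (Q_mat N m G) K) \<longrightarrow>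
      (\<forall>i < dim_row J. row (submatrix J UNIV K) i \<noteq> 0\<^sub>v (card K))"
    using R by (elim conjE)
  have Q: "Q_mat N m G = transpose_mat J * J - mat N N (\<lambda>_. 1)" using R by (elim conjE)
  have entry: "Q_mat N m G $$ (i, j) = real (card (column_support J i \<inter> column_support J j)) - 1"
    if "i < N" "j < N" for i j
    using gram_entry[OF J01] that unfolding Q by (simp add: dim)
  show "column_family (pverts G) (parcs G) (column_support J)"
  proof
    show "finite (column_support J i)" for i by (simp add: column_support_def)
    show "sym (parcs G)" using arcs_symmetric by (rule symI)
    show "irrefl (parcs G)" using no_loops' by (auto simp: irrefl_def)
    fix i j assume ij: "i \<in> pverts G" "j \<in> pverts G"
    show "column_support J i \<inter> column_support J j = {}" if "(i, j) \<in> parcs G"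
    proof -
      have "i \<noteq> j" using no_loops' that by blast
      then have "real (card (column_support J i \<inter> column_support J j)) = 0"
        using entry[of i j] ij that V by (simp add: Q_mat_def)
      then show ?thesis by (simp add: column_support_def)
    qed
    show "card (column_support J i \<inter> column_support J j) = 1" if "i \<noteq> j" "(i, j) \<notin> parcs G"
      using entry[of i j] ij that V by (simp add: Q_mat_def)
  qed
  show "card (column_support J j) = m j + 1" if "j < N"
    using entry[of j j] that by (simp add: Q_mat_def)
  assume K: "K \<in> components G" "\<not> finite_type (component_mat (Q_mat N m G) K)"
  have KN: "K \<subseteq> {0..<N}" using components_subset[OF K(1)] V by simp
  have "{0..<dim_row J} \<subseteq> (\<Union>v\<in>K. column_support J v)"
  proof
    fix r assume "r \<in> {0..<dim_row J}"
    then have r: "r < dim_row J" by simp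
    have "row (submatrix J UNIV K) r \<noteq> 0\<^sub>v (card K)" using cover K r by blast
    then obtain v where v: "v \<in> K" "J $$ (r, v) \<noteq> 0"
      using row_submatrix_zero_iff[OF KN[folded dim] r] by blast
    then have "J $$ (r, v) = 1" using zero_one_entry[OF J01 r] KN dim by fastforce
    then show "r \<in> (\<Union>v\<in>K. column_support J v)" using v r by (auto simp: column_support_def)
  qed
  then show "(\<Union>v\<in>pverts G. column_support J v) = (\<Union>v\<in>K. column_support J v)"
    using KN V by (auto simp: column_support_def)
qed

lemma realizable_imp_plane_labelling:
  assumes V: "pverts G = {0..<N}" and J: "realizable G (Q_mat N m G)"
    and three: "card {K \<in> components G. affine_cartan (component_mat (Q_mat N m G) K)} \<ge> 3"
  shows "\<forall>v<N. m v = 2" and "\<exists>c t. plane_labelling {0..<N} (parcs G) c t"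
proof -
  obtain J where J: "realization G (Q_mat N m G) J" using J unfolding realizable_def by blast
  interpret column_family "pverts G" "parcs G" "column_support J"
    by (rule realization_column_family(1)[OF V J])
  have block: "affine_block K"
    if K: "K \<in> components G" "affine_cartan (component_mat (Q_mat N m G) K)" for K
  proof -
    have KN: "K \<subseteq> {0..<N}" using components_subset[OF K(1)] V by simp
    note null = affine_cartan_null_vector[OF KN components_nonempty[OF K(1)] irrefl_E K(2)]
    have "\<forall>v\<in>K. card (column_support J v) = 3"
      using null(1) realization_column_family(2)[OF V J] KN by auto
    moreover have "\<forall>v\<in>K. \<forall>w\<in>pverts G - K. (v, w) \<notin> parcs G"
      using arc_in_component[OF K(1)] by auto
    ultimately show ?thesis
      unfolding affine_block_def rows_def
      using components_subset[OF K(1)] finite_component[OF K(1)] components_nonempty[OF K(1)] null(2)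
        realization_column_family(3)[OF V J K(1) null(3)] by auto
  qed
  obtain T where T: "T \<subseteq> {K \<in> components G. affine_cartan (component_mat (Q_mat N m G) K)}" "card T = 3"
    using obtain_subset_with_card_n[OF three] by metis
  then obtain K L M where KLM: "T = {K, L, M}" "K \<noteq> L" "K \<noteq> M" "L \<noteq> M"
    by (auto simp: card_3_iff)
  have "K \<inter> L = {}" "K \<inter> M = {}" "L \<inter> M = {}" "affine_block K" "affine_block L" "affine_block M"
    using T(1) KLM components_disjoint block by auto
  note result = three_blocks_plane_labelling[OF this(4-6) this(1-3)]
  show "\<exists>c t. plane_labelling {0..<N} (parcs G) c t" using result(2) unfolding V .
  show "\<forall>v<N. m v = 2" using result(1) realization_column_family(2)[OF V J] V by auto
qed

text \<open>
  The realization is the point-line incidence matrix of the plane, whose points \<open>(x, y)\<close> are numbered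
  \<open>3 x + y\<close>. A component that is not finite has three vertices, so its lines are a whole parallel class
  and cover all points.
\<close>

lemma plane_labelling_imp_realizable:
  assumes V: "pverts G = {0..<N}" and m: "\<forall>v<N. m v = 2"
    and lab: "plane_labelling {0..<N} (parcs G) c t"
  shows "realizable G (Q_mat N m G)"
proof -
  define point :: "nat \<Rightarrow> nat \<times> nat" where "point r = (r div 3, r mod 3)" for r
  have point: "bij_betw point {..<9} grid"
  proof (rule bij_betw_byWitness[where f' = "\<lambda>p. 3 * fst p + snd p"])
    show "\<forall>r\<in>{..<9}. 3 * fst (point r) + snd (point r) = r" by (simp add: point_def)
    show "\<forall>p\<in>grid. point (3 * fst p + snd p) = p" by (auto simp: point_def grid_def)
    show "point ` {..<9} \<subseteq> grid" by (auto simp: point_def grid_def)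
    show "(\<lambda>p. 3 * fst p + snd p) ` grid \<subseteq> {..<9}" by (auto simp: grid_def)
  qed
  define J :: "real mat" where
    "J = mat 9 N (\<lambda>(r, j). if point r \<in> line (c j) (t j) then 1 else 0)"
  have dims: "dim_row J = 9" "dim_col J = N" by (simp_all add: J_def)
  have J01: "elements_mat J \<subseteq> {0, 1}" by (auto simp: J_def dest!: elements_matD split: if_splits)
  have ct: "c j < 4" "t j < 3" if "j < N" for j using plane_labellingD(1,2)[OF lab, of j] that by simp_all
  have meet: "card (column_support J i \<inter> column_support J j) = card (line (c i) (t i) \<inter> line (c j) (t j))"
    if "i < N" "j < N" for i j
  proof -
    have "column_support J i \<inter> column_support J j =
        {r \<in> {..<9}. point r \<in> line (c i) (t i) \<inter> line (c j) (t j)}"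
      using that by (auto simp: column_support_def J_def split: if_splits)
    moreover have "bij_betw point \<dots> {p \<in> grid. p \<in> line (c i) (t i) \<inter> line (c j) (t j)}"
      using point by (rule bij_betw_Collect) simp
    moreover have "{p \<in> grid. p \<in> line (c i) (t i) \<inter> line (c j) (t j)} = line (c i) (t i) \<inter> line (c j) (t j)"
      by (auto simp: line_def)
    ultimately show ?thesis using bij_betw_same_card by metis
  qed
  have inter: "card (column_support J i \<inter> column_support J j) = (if (i, j) \<in> parcs G then 0 else 1)"
    if ij: "i < N" "j < N" "i \<noteq> j" for i j
  proof (cases "c i = c j")
    case True
    then have "t i \<noteq> t j" using plane_labellingD(4)[OF lab, of i j] ij by auto
    then show ?thesis
      using meet[OF ij(1,2)] True line_Int_parallel plane_labellingD(3)[OF lab, of i j] ij by simp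
  next
    case False
    then show ?thesis
      using meet[OF ij(1,2)] card_line_Int ct ij plane_labellingD(3)[OF lab, of i j] by simp
  qed
  have "realization G (Q_mat N m G) J"
    unfolding realization_def
  proof (intro conjI allI impI ballI)
    show "dim_col J = dim_row (Q_mat N m G)" by (simp add: dims Q_mat_def)
    show "elements_mat J \<subseteq> {0, 1}" by (rule J01)
    show "card {i. i < dim_row J \<and> J $$ (i, j) = 1 \<and> J $$ (i, k) = 1} \<le> 1"
      if "j < dim_col J" "k < dim_col J" "j \<noteq> k" for j k
    proof -
      have "{i. i < dim_row J \<and> J $$ (i, j) = 1 \<and> J $$ (i, k) = 1} = column_support J j \<inter> column_support J k"
        by (auto simp: column_support_def)
      then show ?thesis using inter[of j k] that dims by simp
    qed
    show "Q_mat N m G = transpose_mat J * J - mat (dim_row (Q_mat N m G)) (dim_row (Q_mat N m G)) (\<lambda>_. 1)"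
    proof (rule eq_matI)
      fix i j
      assume "i < dim_row (transpose_mat J * J - mat (dim_row (Q_mat N m G)) (dim_row (Q_mat N m G)) (\<lambda>_. 1))"
        "j < dim_col (transpose_mat J * J - mat (dim_row (Q_mat N m G)) (dim_row (Q_mat N m G)) (\<lambda>_. 1))"
      then have ij: "i < N" "j < N" by (simp_all add: Q_mat_def)
      have "card (column_support J i \<inter> column_support J j) =
          (if i = j then 3 else if (i, j) \<in> parcs G then 0 else 1)"
        using inter[OF ij] meet[OF ij] card_line[OF ct[OF ij(1)]] by auto
      then show "Q_mat N m G $$ (i, j) =
          (transpose_mat J * J - mat (dim_row (Q_mat N m G)) (dim_row (Q_mat N m G)) (\<lambda>_. 1)) $$ (i, j)"
        using gram_entry[OF J01, of i j] ij m by (simp add: Q_mat_def dims)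
    qed (simp_all add: Q_mat_def dims)
    fix K r
    assume K: "K \<in> components G" "\<not> finite_type (component_mat (Q_mat N m G) K)" and r: "r < dim_row J"
    have KN: "K \<subseteq> {0..<N}" using components_subset[OF K(1)] V by simp
    note lab' = lab[folded V]
    have "component_mat (Q_mat N m G) K = clique_mat (card K)"
      using component_mat_eq_clique_mat_iff[OF KN] KN m component_clique[OF lab' K(1)] by auto
    then have "\<not> card K \<le> 2" using K(2) finite_type_clique_mat by auto
    then have "card K = 3" using card_component_le_3(1)[OF lab' K(1)] by simp
    then have onto: "t ` K = {..<3}"
      using card_component_le_3(2,3)[OF lab' K(1)] by (simp add: card_subset_eq card_image)
    obtain u where u: "u \<in> K" using components_nonempty[OF K(1)] by blast
    have pr: "point r \<in> grid" using bij_betwE[OF point] r dims by simp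
    then obtain v where v: "v \<in> K" "t v = slope (c u) (point r)"
      using slope_less[OF pr] onto by (metis imageE lessThan_iff)
    then have "point r \<in> line (c v) (t v)"
      using pr component_labelling[OF lab' K(1) u v(1)] by (simp add: line_def)
    then have "J $$ (r, v) \<noteq> 0" using v KN r dims by (auto simp: J_def)
    then show "row (submatrix J UNIV K) r \<noteq> 0\<^sub>v (card K)"
      using row_submatrix_zero_iff[of K J r] KN dims r v(1) by auto
  qed
  then show ?thesis unfolding realizable_def by blast
qed

end

theorem proposition6p7:
  fixes G :: "nat pair_pre_digraph" and m :: "nat \<Rightarrow> nat" and N :: nat
  defines "Q \<equiv> Q_mat N m G"
  assumes "pair_graph G" and "pverts G = {0..<N}"
    and "card {K \<in> components G. affine_cartan (component_mat Q K)} \<ge> 3"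
  shows "realizable G Q \<longleftrightarrow>
    card (components G) \<le> 4 \<and>
    (\<forall>K \<in> components G.
       (finite_type (component_mat Q K) \<or> affine_type (component_mat Q K)) \<and>
       (affine_type (component_mat Q K) \<longrightarrow> component_mat Q K = cartan_A2) \<and>
       (finite_type (component_mat Q K) \<longrightarrow>
          principal_submatrix (component_mat Q K) cartan_A2))"
proof -
  interpret pair_graph G by fact
  interpret nat_pair_graph G ..
  note V = assms(3)
  have KN: "K \<subseteq> {0..<N}" if "K \<in> components G" for K using components_subset[OF that] V by simp
  show ?thesis
  proof (intro iffI conjI ballI impI)
    assume real: "realizable G Q"
    note lab = realizable_imp_plane_labelling[OF V real[unfolded Q_def] assms(4)[unfolded Q_def]]
    obtain c t where ct: "plane_labelling (pverts G) (parcs G) c t" using lab(2) V by auto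
    show "card (components G) \<le> 4" by (rule card_components_le_4[OF ct])
    have clique: "component_mat Q K = clique_mat (card K)" "card K \<le> 3" "card K > 0"
      if "K \<in> components G" for K
      using component_mat_eq_clique_mat_iff[OF KN[OF that], where m = m and G = G and k = "card K"]
        KN[OF that] lab(1) component_clique[OF ct that] card_component_le_3(1)[OF ct that]
        components_nonempty[OF that] finite_component[OF that]
      by (auto simp: Q_def card_gt_0_iff)
    have size: "card K = 3" if K: "K \<in> components G" "affine_type (component_mat Q K)" for K
    proof -
      have "dim_row (component_mat Q K) > 0" using clique[OF K(1)] by (simp add: clique_mat_def)
      then have "\<not> finite_type (clique_mat (card K))"
        using affine_not_finite[OF K(2)] clique(1)[OF K(1)] by simp
      then show ?thesis using finite_type_clique_mat[of "card K"] clique(2)[OF K(1)] by linarith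
    qed
    \<comment> \<open>That \<open>clique_mat 3\<close> is affine is read off from one of the given affine components, which must be
      this matrix because smaller cliques are finite.\<close>
    have "{K \<in> components G. affine_cartan (component_mat Q K)} \<noteq> {}" using assms(4) by force
    then obtain K0 where "K0 \<in> components G" "affine_type (component_mat Q K0)"
      by (auto simp: affine_cartan_def)
    then have affine3: "affine_type (clique_mat 3)" using size[of K0] clique(1)[of K0] by simp
    fix K assume K: "K \<in> components G"
    show "finite_type (component_mat Q K) \<or> affine_type (component_mat Q K)"
    proof (cases "card K \<le> 2")
      case True
      then show ?thesis using finite_type_clique_mat clique(1)[OF K] by simp
    next
      case False
      then have "card K = 3" using clique(2)[OF K] by linarith
      then show ?thesis using affine3 clique(1)[OF K] by simp
    qed
    show "component_mat Q K = cartan_A2" if "affine_type (component_mat Q K)"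
      using size[OF K that] clique(1)[OF K] clique_mat_3 by simp
    show "principal_submatrix (component_mat Q K) cartan_A2"
      using principal_submatrix_cartan_A2_iff clique(1,2)[OF K] by auto
  next
    assume R: "card (components G) \<le> 4 \<and>
      (\<forall>K \<in> components G.
         (finite_type (component_mat Q K) \<or> affine_type (component_mat Q K)) \<and>
         (affine_type (component_mat Q K) \<longrightarrow> component_mat Q K = cartan_A2) \<and>
         (finite_type (component_mat Q K) \<longrightarrow>
            principal_submatrix (component_mat Q K) cartan_A2))"
    have "card K \<le> 3 \<and> (\<forall>v\<in>K. m v = 2) \<and> (\<forall>u\<in>K. \<forall>v\<in>K. u \<noteq> v \<longrightarrow> (u, v) \<in> parcs G)"
      if K: "K \<in> components G" for K
    proof -
      obtain k where "k \<le> 3" "component_mat Q K = clique_mat k"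
        using R K clique_mat_3 principal_submatrix_cartan_A2_iff by (metis order_refl)
      then show ?thesis
        using component_mat_eq_clique_mat_iff[OF KN[OF K], where m = m and G = G and k = k]
        unfolding Q_def by auto
    qed
    note clique = this
    obtain c t where "plane_labelling (pverts G) (parcs G) c t"
      using plane_labelling_if_small_cliques clique R by metis
    moreover have "\<forall>v<N. m v = 2"
    proof (intro allI impI)
      fix v assume "v < N"
      then obtain K where "K \<in> components G" "v \<in> K" using component_of[of v] V by auto
      then show "m v = 2" using clique by blast
    qed
    ultimately show "realizable G Q"
      unfolding Q_def using plane_labelling_imp_realizable[OF V] V by simp
  qed
qed

end
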